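(* Let $X$ be an Asplund space, let $m\ge2$, and let $\bar{x}$ be a rated extremal point of rank $\alpha\in[0,1)$ for a system of sets $\Omega_1,\ldots,\Omega_m\subset X$ locally closed around $\bar{x}$. Then the approximate extremal principle holds for $\{\Omega_1,\ldots,\Omega_m\}$ at $\bar{x}$; that is, for every $\varepsilon>0$ there are $x_i\in\Omega_i\cap(\bar{x}+\varepsilon\mathbb{B})$ and $x_i^*\in\widehat{N}(x_i;\Omega_i)+\varepsilon\mathbb{B}^*$, $i=1,\ldots,m$, such that $$x_1^*+\ldots+x_m^*=0\quad\text{and}\quad\|x_1^*\|^2+\ldots+\|x_m^*\|^2=1.$$
   Context: A Banach space is Asplund if each of its separable subspaces has a separable dual. $\mathbb{B}$ and $\mathbb{B}^*$ are the closed unit balls of $X$ and its dual $X^*$; $B(\bar{x},\rho)$ is the closed ball centered at $\bar{x}$ with radius $\rho$. Rated extremality: for nonempty sets $\Omega_1,\ldots,\Omega_m\subset X$ with common point $\bar{x}$, $\bar{x}$ is a rated extremal point of rank $\alpha$, $0\le\alpha<1$, of $\{\Omega_1,\ldots,\Omega_m\}$ if there are $\gamma>0$ and sequences $\{a_{ik}\}_{k\in\mathbb{N}}\subset X$, $i=1,\ldots,m$, such that $r_k:=\max_i\|a_{ik}\|\to0$ as $k\to\infty$ and $\bigcap_{i=1}^m(\Omega_i-a_{ik})\cap B(\bar{x},\gamma r_k^\alpha)=\emptyset$ for all large $k\in\mathbb{N}$. Fréchet normal cone: $\widehat{N}(x;\Omega):=\{x^*\in X^*\mid\limsup_{u\to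 x,\,u\in\Omega}\frac{\langle x^*,u-x\rangle}{\|u-x\|}\le0\}$ for $x\in\Omega$. *)

theory Defs
  imports "HOL-Analysis.Analysis"
begin

text \<open>
  The dual of a linear subspace \<open>Y\<close>: the bounded linear functionals on \<open>Y\<close>. A functional on \<open>Y\<close>
  is represented by a function on the whole space that vanishes outside \<open>Y\<close>, so that two
  functionals are equal iff they agree on \<open>Y\<close>. The representing function is in general not linear
  on the whole space.
\<close>

definition subspace_dual :: "'a::real_normed_vector set \<Rightarrow> ('a \<Rightarrow> real) set" where
  "subspace_dual Y =
     {f. (\<forall>x\<in>Y. \<forall>y\<in>Y. f (x + y) = f x + f y) \<and>
         (\<forall>c. \<forall>x\<in>Y. f (c *\<^sub>R x) = c * f x) \<and>
         (\<exists>K. \<forall>x\<in>Y. \<bar>f x\<bar> \<le> K * norm x) \<and>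
         (\<forall>x. x \<notin> Y \<longrightarrow> f x = 0)}"

definition subspace_dual_norm :: "'a::real_normed_vector set \<Rightarrow> ('a \<Rightarrow> real) \<Rightarrow> real" where
  "subspace_dual_norm Y f = (SUP y\<in>Y \<inter> cball 0 1. \<bar>f y\<bar>)"

definition separable_dual :: "'a::real_normed_vector set \<Rightarrow> bool" where
  "separable_dual Y \<longleftrightarrow>
     (\<exists>D. countable D \<and> D \<subseteq> subspace_dual Y \<and>
          (\<forall>f\<in>subspace_dual Y. \<forall>e>0. \<exists>g\<in>D. subspace_dual_norm Y (\<lambda>y. f y - g y) < e))"

definition asplund :: "'a::banach itself \<Rightarrow> bool" where
  "asplund _ \<longleftrightarrow>
     (\<forall>Y::'a set. subspace Y \<and> separable_space (top_of_set Y) \<longrightarrow> separable_dual Y)"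

definition locally_closed_around :: "'a::metric_space \<Rightarrow> 'a set \<Rightarrow> bool" where
  "locally_closed_around x S \<longleftrightarrow> (\<exists>\<delta>>0. closed (S \<inter> cball x \<delta>))"

text \<open>
  The value \<open>0 powr 0 = 0\<close> (instead of \<open>1\<close>) plays no role below: if \<open>r k = 0\<close>, then all \<open>a i k\<close> are
  zero and \<open>x\<close> belongs to the intersection whatever the radius of the ball.
\<close>

definition rated_extremal_point ::
    "nat \<Rightarrow> (nat \<Rightarrow> 'a::real_normed_vector set) \<Rightarrow> real \<Rightarrow> 'a \<Rightarrow> bool" where
  "rated_extremal_point m \<Omega> \<alpha> x \<longleftrightarrow>
     0 \<le> \<alpha> \<and> \<alpha> < 1 \<and> (\<forall>i\<in>{1..m}. x \<in> \<Omega> i) \<and>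
     (\<exists>\<gamma>>0. \<exists>a :: nat \<Rightarrow> nat \<Rightarrow> 'a.
        let r = (\<lambda>k. Max ((\<lambda>i. norm (a i k)) ` {1..m})) in
          r \<longlonglongrightarrow> 0 \<and>
          (\<forall>\<^sub>F k in sequentially.
             (\<Inter>i\<in>{1..m}. (\<lambda>u. u - a i k) ` \<Omega> i) \<inter> cball x (\<gamma> * r k powr \<alpha>) = {}))"

text \<open>
  The filter \<open>at x within S\<close> excludes \<open>u = x\<close>. At an isolated point of \<open>S\<close> the upper limit is
  \<open>-\<infinity>\<close>, so the cone is the whole dual space. Off \<open>S\<close> the cone is set to be empty.
\<close>

definition frechet_normal_cone ::
    "'a::real_normed_vector \<Rightarrow> 'a set \<Rightarrow> ('a \<Rightarrow>\<^sub>L real) set" where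
  "frechet_normal_cone x S =
     {xs. x \<in> S \<and>
          Limsup (at x within S) (\<lambda>u. ereal (blinfun_apply xs (u - x) / norm (u - x))) \<le> 0}"

end

theory Submission
  imports Defs
begin

text \<open>
  Neither separable reduction of subdifferentials nor smooth renorming is used. A sublinear
  function on an Asplund space is almost Frechet differentiable somewhere (otherwise Baire's
  theorem fails in a suitable separable subspace). Applied to the maximal slope of a Lipschitz
  function, this gives Frechet \<open>\<epsilon>\<close>-subgradients of the function at a dense set of points.
  Subgradients of marginal functions then yield a fuzzy sum rule. By Ekeland's principle the sum of
  the distances to the shifted sets almost attains its minimum at a point where it is positive; the
  sum rule splits the zero subgradient there into \<open>\<epsilon>\<close>-normals with sum zero, at least one of them
  of norm near one. Finally an \<open>\<epsilon>\<close>-normal is within a multiple of \<open>\<epsilon>\<close> of an exact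
  Frechet normal at a nearby point, by repeated halving of \<open>\<epsilon>\<close>.
\<close>

subsection \<open>Supporting functionals and Ekeland's principle\<close>

text \<open>The rank enters through a comparison of sizes. At \<open>xbar\<close> the sum of the
  distances is at most \<open>m * r\<close>, where \<open>r\<close> is the largest norm of a shift,
  so a minimizer up to slope \<open>\<sigma>\<close> is found within
  \<open>m * r / \<sigma>\<close>. The shifted sets are known to have no common point only in a ball
  of radius \<open>\<gamma> * r powr \<alpha>\<close>. Since \<alpha> < 1, \<open>r\<close> is small
  against this radius, and the point found stays in the ball. Two obstacles shape the rest. Nearest
  points of a closed set need not exist, so a subgradient of a distance function yields a normal
  inequality only with an additive error. And the radius obtained after halving \<epsilon> is not
  under control: it may be far smaller than the previous one. The scales in between are covered by a
  second inequality, for the old functional. The exact normals need not sum to zero. The functionals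
  of the theorem are the rescaled \<epsilon>-normals, and the ball added to the normal cone absorbs
  the difference.\<close>

definition sublinear :: "('a::real_vector \<Rightarrow> real) \<Rightarrow> bool" where
  "sublinear p \<longleftrightarrow> (\<forall>x y. p (x + y) \<le> p x + p y) \<and> (\<forall>c x. 0 \<le> c \<longrightarrow> p (c *\<^sub>R x) = c * p x)"

lemma sublinearI:
  assumes add: "\<And>x y. p (x + y) \<le> p x + p y"
    and scale: "\<And>c x. 0 < c \<Longrightarrow> p (c *\<^sub>R x) \<le> c * p x"
    and zero: "p 0 = 0"
  shows "sublinear p"
  unfolding sublinear_def
proof (intro conjI allI impI add)
  fix c :: real and x :: 'a
  assume "0 \<le> c"
  show "p (c *\<^sub>R x) = c * p x"
  proof (cases "c = 0")
    case False
    with \<open>0 \<le> c\<close> have c: "c > 0" by simp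
    have "p (inverse c *\<^sub>R (c *\<^sub>R x)) \<le> inverse c * p (c *\<^sub>R x)"
      using c by (intro scale) simp
    then have "c * p x \<le> p (c *\<^sub>R x)" using c by (simp add: field_simps)
    with scale[OF c, of x] show ?thesis by simp
  qed (simp add: zero)
qed

lemma sublinear_add: "sublinear p \<Longrightarrow> p (x + y) \<le> p x + p y"
  and sublinear_scale: "sublinear p \<Longrightarrow> 0 \<le> c \<Longrightarrow> p (c *\<^sub>R x) = c * p x"
  by (auto simp: sublinear_def)

lemma sublinear_zero: "sublinear p \<Longrightarrow> p 0 = 0"
  using sublinear_scale[of p 0 0] by simp

lemma sublinear_minus: "sublinear p \<Longrightarrow> - p (- x) \<le> p x"
  using sublinear_add[of p x "- x"] sublinear_zero[of p] by simp

text \<open>\<open>q'\<close> is the largest sublinear function below \<open>q\<close> whose value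
  at \<open>- k\<close> is at most \<open>- q k\<close>: subadditivity forces the bound
  \<open>q (x + t *\<^sub>R k) - t * q k\<close> on any such function. The infimum over
  \<open>t\<close> is finite since \<open>- q (- x)\<close> is a lower bound.\<close>

lemma sublinear_tilt:
  assumes q: "sublinear q"
  obtains q' where "sublinear q'" "q' \<le> q" "q' (- k) \<le> - q k"
proof -
  define q' where "q' x = (INF t\<in>{0..}. q (x + t *\<^sub>R k) - t * q k)" for x
  have lower: "- q (- x) \<le> q (x + t *\<^sub>R k) - t * q k" if "0 \<le> t" for x t
  proof -
    have "t * q k = q (- x + (x + t *\<^sub>R k))" using sublinear_scale[OF q that] by simp
    also have "\<dots> \<le> q (- x) + q (x + t *\<^sub>R k)" by (rule sublinear_add[OF q])
    finally show ?thesis by simp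
  qed
  have le: "q' x \<le> q (x + t *\<^sub>R k) - t * q k" if "0 \<le> t" for x t
    unfolding q'_def using that lower
    by (intro cINF_lower bdd_belowI2[where m = "- q (- x)"]) auto
  have ge: "b \<le> q' x" if "\<And>t. 0 \<le> t \<Longrightarrow> b \<le> q (x + t *\<^sub>R k) - t * q k" for b x
    unfolding q'_def using that by (intro cINF_greatest) auto
  have "sublinear q'"
  proof (rule sublinearI)
    fix x y
    have "q' (x + y) - (q (y + s *\<^sub>R k) - s * q k) \<le> q' x" if s: "0 \<le> s" for s
    proof (rule ge)
      fix t :: real
      assume t: "0 \<le> t"
      have "q' (x + y) \<le> q ((x + y) + (s + t) *\<^sub>R k) - (s + t) * q k"
        using s t by (intro le) simp
      also have "(x + y) + (s + t) *\<^sub>R k = (x + t *\<^sub>R k) + (y + s *\<^sub>R k)"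
        by (simp add: algebra_simps)
      also have "q \<dots> \<le> q (x + t *\<^sub>R k) + q (y + s *\<^sub>R k)" by (rule sublinear_add[OF q])
      finally show "q' (x + y) - (q (y + s *\<^sub>R k) - s * q k) \<le> q (x + t *\<^sub>R k) - t * q k"
        by (simp add: algebra_simps)
    qed
    then have "q' (x + y) - q' x \<le> q' y" by (intro ge) (simp add: algebra_simps)
    then show "q' (x + y) \<le> q' x + q' y" by simp
  next
    fix c :: real and x
    assume c: "0 < c"
    have "q' (c *\<^sub>R x) / c \<le> q' x"
    proof (rule ge)
      fix t :: real
      assume t: "0 \<le> t"
      have "q' (c *\<^sub>R x) \<le> q (c *\<^sub>R x + (c * t) *\<^sub>R k) - (c * t) * q k"
        using c t by (intro le) simp
      also have "c *\<^sub>R x + (c * t) *\<^sub>R k = c *\<^sub>R (x + t *\<^sub>R k)" by (simp add: algebra_simps)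
      also have "q \<dots> = c * q (x + t *\<^sub>R k)" using c by (intro sublinear_scale[OF q]) simp
      finally show "q' (c *\<^sub>R x) / c \<le> q (x + t *\<^sub>R k) - t * q k"
        using c by (simp add: field_simps)
    qed
    then show "q' (c *\<^sub>R x) \<le> c * q' x" using c by (simp add: field_simps)
  next
    have "0 \<le> q' 0" by (intro ge) (simp add: sublinear_scale[OF q])
    moreover have "q' 0 \<le> 0" using le[of 0 0] sublinear_zero[OF q] by simp
    ultimately show "q' 0 = 0" by simp
  qed
  moreover have "q' \<le> q" using le[of 0] by (simp add: le_fun_def)
  moreover have "q' (- k) \<le> - q k" using le[of 1 "- k"] sublinear_zero[OF q] by simp
  ultimately show ?thesis by (rule that)
qed

text \<open>Zorn's lemma for the reversed order. The pointwise infimum of a chain is finite because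
  every member is at least \<open>- p (- x)\<close>, and subadditive because the smaller of two
  members estimates both summands at once.\<close>

lemma sublinear_minimal_exists:
  assumes p: "sublinear p"
  obtains q where "sublinear q" "q \<le> p" "\<And>q'. sublinear q' \<Longrightarrow> q' \<le> q \<Longrightarrow> q' = q"
proof -
  let ?A = "{q. sublinear q \<and> q \<le> p}"
  let ?P = "\<lambda>q r :: 'a \<Rightarrow> real. r \<le> q"
  have "\<exists>m\<in>?A. \<forall>a\<in>?A. ?P m a \<longrightarrow> a = m"
  proof (rule predicate_Zorn)
    show "partial_order_on ?A (relation_of ?P ?A)"
      by (rule partial_order_on_relation_ofI) auto
  next
    fix C
    assume C: "C \<in> Chains (relation_of ?P ?A)"
    have sub: "sublinear q" "q \<le> p" if "q \<in> C" for q
      using C that by (auto simp: Chains_def relation_of_def)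
    have total: "q \<le> r \<or> r \<le> q" if "q \<in> C" "r \<in> C" for q r
      using C that by (auto simp: Chains_def relation_of_def)
    show "\<exists>u\<in>?A. \<forall>a\<in>C. ?P a u"
    proof (cases "C = {}")
      case True
      then show ?thesis using p by auto
    next
      case False
      define u where "u x = (INF q\<in>C. q x)" for x
      have "- p (- x) \<le> q x" if "q \<in> C" for q x
        using sublinear_minus[OF sub(1)[OF that], of x] sub(2)[OF that]
        by (auto simp: le_fun_def dest: spec[of _ "- x"])
      then have le: "u x \<le> q x" if "q \<in> C" for q x
        unfolding u_def using that by (intro cINF_lower bdd_belowI2[where m = "- p (- x)"]) auto
      have ge: "b \<le> u x" if "\<And>q. q \<in> C \<Longrightarrow> b \<le> q x" for b x
        unfolding u_def using that False by (intro cINF_greatest) auto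
      have "sublinear u"
      proof (rule sublinearI)
        fix x y
        have "u (x + y) - r y \<le> u x" if r: "r \<in> C" for r
        proof (rule ge)
          fix q
          assume q: "q \<in> C"
          obtain s where s: "s \<in> C" "s \<le> q" "s \<le> r" using total[OF q r] q r by auto
          have "u (x + y) \<le> s x + s y"
            using le[OF s(1), of "x + y"] sublinear_add[OF sub(1)[OF s(1)], of x y] by simp
          also have "\<dots> \<le> q x + r y" using s(2,3) by (intro add_mono) (auto simp: le_fun_def)
          finally show "u (x + y) - r y \<le> q x" by simp
        qed
        then have "u (x + y) - u x \<le> u y" by (intro ge) (simp add: algebra_simps)
        then show "u (x + y) \<le> u x + u y" by simp
      next
        fix c :: real and x
        assume c: "0 < c"
        have "u (c *\<^sub>R x) / c \<le> u x"
        proof (rule ge)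
          fix q
          assume q: "q \<in> C"
          show "u (c *\<^sub>R x) / c \<le> q x"
            using le[OF q, of "c *\<^sub>R x"] sublinear_scale[OF sub(1)[OF q], of c x] c
            by (simp add: field_simps)
        qed
        then show "u (c *\<^sub>R x) \<le> c * u x" using c by (simp add: field_simps)
      next
        obtain q where q: "q \<in> C" using False by auto
        then have "u 0 \<le> 0" using le[OF q, of 0] sublinear_zero[OF sub(1)[OF q]] by simp
        moreover have "0 \<le> u 0" using sub(1) by (intro ge) (simp add: sublinear_zero)
        ultimately show "u 0 = 0" by simp
      qed
      moreover have "u \<le> p"
      proof -
        obtain q where q: "q \<in> C" using False by auto
        then have "u \<le> q" using le by (simp add: le_fun_def)
        also have "q \<le> p" by (rule sub(2)[OF q])
        finally show ?thesis .
      qed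
      ultimately show ?thesis using le by (auto simp: le_fun_def)
    qed
  qed
  then show ?thesis using that by (metis (mono_tags, lifting) mem_Collect_eq order_trans)
qed

text \<open>Hahn-Banach without extension from subspaces: tilting at \<open>h\<close> forces the
  value there, and a minimal sublinear function is odd, since its tilt at any \<open>k\<close>
  cannot be smaller. An odd sublinear function is linear.\<close>

theorem sublinear_support:
  assumes p: "sublinear p"
  obtains g where "linear g" "\<And>x. g x \<le> p x" "g h = p h"
proof -
  obtain p' where p': "sublinear p'" "p' \<le> p" "p' (- h) \<le> - p h"
    using sublinear_tilt[OF p] .
  obtain q where q: "sublinear q" "q \<le> p'"
    and minimal: "\<And>q'. sublinear q' \<Longrightarrow> q' \<le> q \<Longrightarrow> q' = q"
    using sublinear_minimal_exists[OF p'(1)] by blast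
  have minus: "q (- k) = - q k" for k
  proof -
    obtain q' where "sublinear q'" "q' \<le> q" "q' (- k) \<le> - q k"
      using sublinear_tilt[OF q(1)] .
    with minimal[of q'] have "q (- k) \<le> - q k" by simp
    with sublinear_minus[OF q(1), of k] show ?thesis by simp
  qed
  have "linear q"
  proof (rule linearI)
    fix x y
    have "q x = q ((x + y) + - y)" by simp
    also have "\<dots> \<le> q (x + y) - q y" using sublinear_add[OF q(1), of "x + y" "- y"] minus by simp
    finally show "q (x + y) = q x + q y" using sublinear_add[OF q(1), of x y] by simp
  next
    fix c :: real and x
    show "q (c *\<^sub>R x) = c *\<^sub>R q x"
    proof (cases "0 \<le> c")
      case False
      then show ?thesis
        using sublinear_scale[OF q(1), of "- c" x] minus[of "c *\<^sub>R x"] by simp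
    qed (simp add: sublinear_scale[OF q(1)])
  qed
  moreover have le: "q x \<le> p x" for x
    using q(2) p'(2) by (auto simp: le_fun_def intro: order_trans)
  moreover have "q (- h) \<le> - p h" using q(2) p'(3) by (auto simp: le_fun_def intro: order_trans)
  then have "q h = p h" using minus le[of h] by simp
  ultimately show ?thesis by (rule that)
qed

text \<open>\<open>S x\<close> is the set of points below \<open>x\<close> in Ekeland's order. Each
  iterate nearly minimizes \<open>\<psi>\<close> over the set of the previous one, which makes these
  sets shrink to the limit. The second conclusion turns any bound on \<open>\<psi> x0 - b\<close>
  into a bound on the distance moved.\<close>

lemma ekeland:
  fixes \<psi> :: "'a::metric_space \<Rightarrow> real"
  assumes M: "complete M" "x0 \<in> M" and cont: "continuous_on M \<psi>"
    and bdd: "\<And>x. x \<in> M \<Longrightarrow> b \<le> \<psi> x" and \<tau>: "0 < \<tau>"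
  obtains x where "x \<in> M" "\<psi> x + \<tau> * dist x x0 \<le> \<psi> x0"
    "\<And>y. y \<in> M \<Longrightarrow> \<psi> x - \<tau> * dist y x \<le> \<psi> y"
proof -
  define S where "S x = {y \<in> M. \<psi> y + \<tau> * dist y x \<le> \<psi> x}" for x
  have self: "x \<in> S x" if "x \<in> M" for x using that by (simp add: S_def)
  have trans: "S y \<subseteq> S x" if "y \<in> S x" for x y
  proof
    fix z
    assume z: "z \<in> S y"
    have "\<tau> * dist z x \<le> \<tau> * dist z y + \<tau> * dist y x"
      using \<tau> dist_triangle[of z x y] by (simp flip: distrib_left)
    then show "z \<in> S x" using that z by (auto simp: S_def)
  qed
  have "\<exists>y\<in>S x. \<forall>z\<in>S x. \<psi> y \<le> \<psi> z + e" if x: "x \<in> M" and e: "0 < e" for x e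
  proof -
    have bd: "bdd_below (\<psi> ` S x)" using bdd by (intro bdd_belowI2[where m = b]) (auto simp: S_def)
    have "(INF z\<in>S x. \<psi> z) < (INF z\<in>S x. \<psi> z) + e" using e by simp
    then obtain y where "y \<in> S x" "\<psi> y < (INF z\<in>S x. \<psi> z) + e"
      using cINF_less_iff[OF _ bd] self[OF x] by blast
    moreover have "(INF z\<in>S x. \<psi> z) \<le> \<psi> z" if "z \<in> S x" for z
      using bd that by (rule cINF_lower)
    ultimately show ?thesis by (meson add_right_mono less_imp_le order_trans)
  qed
  then obtain N where N: "\<And>x e. x \<in> M \<Longrightarrow> 0 < e \<Longrightarrow> N x e \<in> S x"
    "\<And>x e z. x \<in> M \<Longrightarrow> 0 < e \<Longrightarrow> z \<in> S x \<Longrightarrow> \<psi> (N x e) \<le> \<psi> z + e"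
    by metis
  define xs where "xs = rec_nat x0 (\<lambda>n x. N x ((1/2) ^ n))"
  have xs0: "xs 0 = x0" and xsS: "xs (Suc n) = N (xs n) ((1/2) ^ n)" for n
    by (simp_all add: xs_def)
  have inM: "xs n \<in> M" for n
  proof (induction n)
    case (Suc n)
    then show ?case using N(1)[OF Suc, of "(1/2)^n"] by (simp add: xsS S_def)
  qed (simp add: xs0 M)
  have step: "xs (Suc n) \<in> S (xs n)" for n using N(1)[OF inM] by (simp add: xsS)
  have mono: "xs (n + k) \<in> S (xs n)" for n k
  proof (induction k)
    case (Suc k)
    then show ?case using step[of "n + k"] trans[of "xs (n + k)" "xs n"] by auto
  qed (simp add: self inM)
  \<comment> \<open>\<open>xs (Suc n)\<close> is within \<open>(1/2) ^ n\<close> of the infimum of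
    \<open>\<psi>\<close> over \<open>S (xs n)\<close>, so no point below it in the order can be far
    away.\<close>
  have small: "\<tau> * dist z (xs (Suc n)) \<le> (1/2) ^ n" if "z \<in> S (xs (Suc n))" for z n
  proof -
    have "z \<in> S (xs n)" using that trans[OF step] by auto
    then have "\<psi> (xs (Suc n)) \<le> \<psi> z + (1/2) ^ n" using N(2)[OF inM] by (simp add: xsS)
    with that show ?thesis by (auto simp: S_def)
  qed
  have "Cauchy xs"
  proof (rule metric_CauchyI)
    fix e :: real
    assume "0 < e"
    then have "0 < \<tau> * e / 2" using \<tau> by simp
    then obtain n where n: "(1/2::real) ^ n < \<tau> * e / 2" using real_arch_pow_inv[of "\<tau> * e / 2" "1/2"] by auto
    have "dist (xs k) (xs (Suc n)) < e / 2" if "k \<ge> Suc n" for k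
    proof -
      have "\<tau> * dist (xs k) (xs (Suc n)) \<le> (1/2) ^ n"
        using small mono[of "Suc n" "k - Suc n"] that by simp
      with n have "\<tau> * dist (xs k) (xs (Suc n)) < \<tau> * (e / 2)" by simp
      then show ?thesis using \<tau> by (simp only: mult_less_cancel_left_pos)
    qed
    then show "\<exists>n. \<forall>k\<ge>n. \<forall>l\<ge>n. dist (xs k) (xs l) < e"
      by (meson dist_triangle_half_l dist_commute)
  qed
  then obtain x where x: "x \<in> M" "xs \<longlonglongrightarrow> x"
    using M(1) inM by (meson complete_def)
  have \<psi>lim: "(\<lambda>n. \<psi> (xs n)) \<longlonglongrightarrow> \<psi> x"
    using continuous_on_tendsto_compose[OF cont x(2,1)] inM by simp
  have inS: "x \<in> S (xs n)" for n
  proof -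
    have "(\<lambda>k. \<psi> (xs (n + k)) + \<tau> * dist (xs (n + k)) (xs n)) \<longlonglongrightarrow> \<psi> x + \<tau> * dist x (xs n)"
      using LIMSEQ_ignore_initial_segment[OF \<psi>lim, of n] LIMSEQ_ignore_initial_segment[OF x(2), of n]
      by (auto intro!: tendsto_intros simp: add.commute)
    then have "\<psi> x + \<tau> * dist x (xs n) \<le> \<psi> (xs n)"
      by (rule LIMSEQ_le_const2) (use mono[of n] in \<open>auto simp: S_def\<close>)
    then show ?thesis using x by (simp add: S_def)
  qed
  \<comment> \<open>A point violating this would lie in every \<open>S (xs (Suc n))\<close>, hence
    at distance zero from the limit.\<close>
  have "\<psi> x - \<tau> * dist y x \<le> \<psi> y" if y: "y \<in> M" for y
  proof (rule ccontr)
    assume "\<not> ?thesis"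
    then have "y \<in> S x" "y \<noteq> x" using y by (auto simp: S_def)
    then have "\<tau> * dist y (xs (Suc n)) \<le> (1/2) ^ n" for n
      using small trans[OF inS] by auto
    moreover have "(\<lambda>n. \<tau> * dist y (xs (Suc n))) \<longlonglongrightarrow> \<tau> * dist y x"
      using LIMSEQ_Suc[OF x(2)] by (intro tendsto_intros)
    moreover have "(\<lambda>n. (1/2::real) ^ n) \<longlonglongrightarrow> 0" by (rule LIMSEQ_realpow_zero) auto
    ultimately have "\<tau> * dist y x \<le> 0" by (intro LIMSEQ_le) auto
    with \<tau> \<open>y \<noteq> x\<close> show False by (simp add: mult_le_0_iff)
  qed
  moreover have "\<psi> x + \<tau> * dist x x0 \<le> \<psi> x0" using inS[of 0] by (simp add: S_def xs0)
  ultimately show ?thesis using that x(1) by blast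
qed

subsection \<open>Differentiability of sublinear functions on Asplund spaces\<close>

lemma sublinear_lipschitz:
  assumes p: "sublinear p" and L: "\<And>x. p x \<le> L * norm x"
  shows "\<bar>p x - p y\<bar> \<le> L * norm (x - y)"
  using sublinear_add[OF p, of y "x - y"] sublinear_add[OF p, of x "y - x"]
    L[of "x - y"] L[of "y - x"] by (simp add: norm_minus_commute)

text \<open>By convexity the second difference divided by the length does not decrease when
  \<open>w\<close> is stretched, so a violation at a short vector gives one of any larger prescribed
  length.\<close>

lemma sublinear_second_difference:
  assumes p: "sublinear p" and s: "1 \<le> s"
  shows "s * (p (h + w) + p (h - w) - 2 * p h)
    \<le> p (h + s *\<^sub>R w) + p (h - s *\<^sub>R w) - 2 * p h"
proof -
  have "s * p (h + v) \<le> (s - 1) * p h + p (h + s *\<^sub>R v)" for v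
  proof -
    have "s * p (h + v) = p (s *\<^sub>R (h + v))" using s by (simp add: sublinear_scale[OF p])
    also have "s *\<^sub>R (h + v) = (s - 1) *\<^sub>R h + (h + s *\<^sub>R v)" by (simp add: algebra_simps)
    also have "p \<dots> \<le> p ((s - 1) *\<^sub>R h) + p (h + s *\<^sub>R v)" by (rule sublinear_add[OF p])
    finally show ?thesis using s by (simp add: sublinear_scale[OF p])
  qed
  from this[of w] this[of "- w"] show ?thesis by (simp add: algebra_simps)
qed

lemma linear_le_sublinear_norm:
  assumes g: "linear g" "\<And>x. g x \<le> p x" and p: "\<And>x. p x \<le> L * norm x"
  shows "\<bar>g x\<bar> \<le> L * norm x"
  using g(2)[of x] g(2)[of "- x"] p[of x] p[of "- x"] linear_neg[OF g(1), of x] by simp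

section \<open>Separable subspaces and their duals\<close>

lemma countable_rational_hull:
  fixes W :: "'a::real_normed_vector \<Rightarrow> nat \<Rightarrow> 'a"
  obtains D where "countable D" "0 \<in> D"
    "\<And>x y. x \<in> D \<Longrightarrow> y \<in> D \<Longrightarrow> x + y \<in> D"
    "\<And>r x. x \<in> D \<Longrightarrow> of_rat r *\<^sub>R x \<in> D"
    "\<And>x n. x \<in> D \<Longrightarrow> W x n \<in> D"
proof -
  define F where "F S = S \<union> (\<lambda>(x, y). x + y) ` (S \<times> S)
    \<union> (\<lambda>(r, x). of_rat r *\<^sub>R x) ` (UNIV \<times> S) \<union> (\<lambda>(x, n). W x n) ` (S \<times> UNIV)" for S
  define D where "D n = (F ^^ n) {0}" for n
  have D_Suc: "D (Suc n) = F (D n)" for n by (simp add: D_def)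
  have countable: "countable (D n)" for n
  proof (induction n)
    case (Suc n)
    then show ?case unfolding D_Suc F_def by auto
  qed (simp add: D_def)
  have mono: "D m \<subseteq> D n" if "m \<le> n" for m n
    using that by (rule lift_Suc_mono_le[rotated]) (auto simp: D_Suc F_def)
  have inF: "x + y \<in> F S" "of_rat r *\<^sub>R x \<in> F S" "W x n \<in> F S" if "x \<in> S" "y \<in> S"
    for x y r n S using that by (auto simp: F_def image_iff)
  show ?thesis
  proof (rule that[of "\<Union>n. D n"])
    show "countable (\<Union>n. D n)" using countable by simp
    have "0 \<in> D 0" by (simp add: D_def)
    then show "0 \<in> (\<Union>n. D n)" by blast
  next
    fix x y
    assume "x \<in> (\<Union>n. D n)" "y \<in> (\<Union>n. D n)"
    then obtain m n where xy: "x \<in> D m" "y \<in> D n" by blast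
    then have "x \<in> D (max m n)" "y \<in> D (max m n)"
      using mono[of m "max m n"] mono[of n "max m n"] by auto
    then have "x + y \<in> D (Suc (max m n))" unfolding D_Suc by (rule inF)
    then show "x + y \<in> (\<Union>n. D n)" by blast
  next
    fix x r
    assume "x \<in> (\<Union>n. D n)"
    then obtain m where x: "x \<in> D m" by blast
    have "of_rat r *\<^sub>R x \<in> D (Suc m)" unfolding D_Suc by (rule inF(2)[OF x x])
    then show "of_rat r *\<^sub>R x \<in> (\<Union>n. D n)" by blast
  next
    fix x n
    assume "x \<in> (\<Union>n. D n)"
    then obtain m where x: "x \<in> D m" by blast
    have "W x n \<in> D (Suc m)" unfolding D_Suc by (rule inF(3)[OF x x])
    then show "W x n \<in> (\<Union>n. D n)" by blast
  qed
qed

lemma subspace_closure_rational: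
  fixes D :: "'a::real_normed_vector set"
  assumes "0 \<in> D" and add: "\<And>x y. x \<in> D \<Longrightarrow> y \<in> D \<Longrightarrow> x + y \<in> D"
    and scale: "\<And>r x. x \<in> D \<Longrightarrow> of_rat r *\<^sub>R x \<in> D"
  shows "subspace (closure D)"
proof (rule subspaceI)
  show "0 \<in> closure D" using assms(1) closure_subset by auto
next
  fix x y
  assume "x \<in> closure D" "y \<in> closure D"
  then obtain f g where "\<And>n. f n \<in> D" "f \<longlonglongrightarrow> x" "\<And>n. g n \<in> D" "g \<longlonglongrightarrow> y"
    by (meson closure_sequential)
  then show "x + y \<in> closure D"
    unfolding closure_sequential by (intro exI[of _ "\<lambda>n. f n + g n"]) (auto intro: add tendsto_add)
next
  fix c :: real and x
  assume "x \<in> closure D"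
  then obtain f where f: "\<And>n. f n \<in> D" "f \<longlonglongrightarrow> x" by (meson closure_sequential)
  have "c \<in> closure \<rat>" by (simp add: Rats_closure_real)
  then obtain g where g: "\<And>n. g n \<in> \<rat>" "g \<longlonglongrightarrow> c" by (meson closure_sequential)
  have "g n *\<^sub>R f n \<in> D" for n using g(1)[of n] f(1)[of n] by (auto elim!: Rats_cases intro: scale)
  then show "c *\<^sub>R x \<in> closure D"
    unfolding closure_sequential using f(2) g(2)
    by (intro exI[of _ "\<lambda>n. g n *\<^sub>R f n"]) (auto intro: tendsto_scaleR)
qed

lemma subspace_dual_restrict:
  assumes "linear g" "\<And>x. \<bar>g x\<bar> \<le> K * norm x" "subspace Y"
  shows "(\<lambda>x. if x \<in> Y then g x else 0) \<in> subspace_dual Y"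
proof -
  have "c *\<^sub>R x \<in> Y \<or> c = 0 \<or> x \<notin> Y" for c x using subspace_scale[OF assms(3)] by blast
  then show ?thesis
    using assms unfolding subspace_dual_def
    by (auto simp: subspace_add linear_add linear_scale subspace_scale)
qed

lemma subspace_dual_bounded:
  assumes "f \<in> subspace_dual Y"
  obtains K where "0 \<le> K" "\<And>x. x \<in> Y \<Longrightarrow> \<bar>f x\<bar> \<le> K * norm x"
proof -
  have "\<exists>K. \<forall>x\<in>Y. \<bar>f x\<bar> \<le> K * norm x" using assms by (simp add: subspace_dual_def)
  then obtain K where K: "\<And>x. x \<in> Y \<Longrightarrow> \<bar>f x\<bar> \<le> K * norm x" by blast
  have "K * norm x \<le> \<bar>K\<bar> * norm x" for x :: 'a by (simp add: mult_right_mono)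
  with K show ?thesis by (intro that[of "\<bar>K\<bar>"]) (auto intro: order_trans)
qed

lemma subspace_dual_norm_bound:
  assumes f: "f \<in> subspace_dual Y" "g \<in> subspace_dual Y" and Y: "subspace Y" "y \<in> Y"
  shows "\<bar>f y - g y\<bar> \<le> subspace_dual_norm Y (\<lambda>y. f y - g y) * norm y"
proof (cases "y = 0")
  case True
  with f Y show ?thesis unfolding subspace_dual_def by (force dest: spec[of _ 0])
next
  case False
  obtain K1 where K1: "0 \<le> K1" "\<And>x. x \<in> Y \<Longrightarrow> \<bar>f x\<bar> \<le> K1 * norm x"
    using subspace_dual_bounded[OF f(1)] by blast
  obtain K2 where K2: "0 \<le> K2" "\<And>x. x \<in> Y \<Longrightarrow> \<bar>g x\<bar> \<le> K2 * norm x"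
    using subspace_dual_bounded[OF f(2)] by blast
  have "\<bar>f x - g x\<bar> \<le> K1 + K2" if "x \<in> Y \<inter> cball 0 1" for x
    using K1(2)[of x] K2(2)[of x] mult_left_le[OF _ K1(1), of "norm x"]
      mult_left_le[OF _ K2(1), of "norm x"] that by simp
  then have bdd: "bdd_above ((\<lambda>y. \<bar>f y - g y\<bar>) ` (Y \<inter> cball 0 1))" by (rule bdd_aboveI2)
  define c where "c = inverse (norm y)"
  have c: "c > 0" "c * norm y = 1" using False by (simp_all add: c_def)
  have "c *\<^sub>R y \<in> Y \<inter> cball 0 1" using Y c by (simp add: subspace_scale)
  then have "\<bar>f (c *\<^sub>R y) - g (c *\<^sub>R y)\<bar> \<le> subspace_dual_norm Y (\<lambda>y. f y - g y)"
    unfolding subspace_dual_norm_def by (intro cSUP_upper bdd)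
  moreover have "f (c *\<^sub>R y) - g (c *\<^sub>R y) = c * (f y - g y)"
    using f Y by (simp add: subspace_dual_def algebra_simps)
  ultimately have "c * \<bar>f y - g y\<bar> \<le> subspace_dual_norm Y (\<lambda>y. f y - g y)"
    using c by (simp add: abs_mult)
  then have "c * \<bar>f y - g y\<bar> * norm y \<le> subspace_dual_norm Y (\<lambda>y. f y - g y) * norm y"
    by (rule mult_right_mono) simp
  then show ?thesis using c by (metis mult.commute mult.left_neutral mult.assoc)
qed


text \<open>
  The failure of differentiability is measured by second differences, which do not mention
  functionals; this is what lets it pass to a separable subspace.
\<close>

lemma approximated_subgradients_nowhere_dense:
  fixes p :: "'a::banach \<Rightarrow> real"
  assumes p: "sublinear p" and L: "0 \<le> L" "\<And>x. p x \<le> L * norm x" and \<epsilon>: "0 < \<epsilon>"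
    and Y: "subspace Y" "h \<in> Y" "w \<in> Y" "w \<noteq> 0"
    and f: "f \<in> subspace_dual Y"
    and d: "\<epsilon> * norm w < p (h + w) + p (h - w) - 2 * p h"
  obtains y r where "y \<in> Y" "norm (y - h) = norm w" "0 < r"
    "\<forall>z\<in>Y. norm (z - y) \<le> r \<longrightarrow> \<not> (\<exists>g. linear g \<and> (\<forall>x. g x \<le> p x) \<and> g z = p z \<and>
      (\<forall>x\<in>Y. \<bar>g x - f x\<bar> \<le> \<epsilon> / 8 * norm x))"
proof -
  have f_add: "f (x + y) = f x + f y" and f_scale: "f (c *\<^sub>R x) = c * f x"
    if "x \<in> Y" "y \<in> Y" for x y c
    using f that by (auto simp: subspace_dual_def)
  have f_uminus: "f (- w) = - f w" using f_scale[of w w "-1"] Y by simp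
  obtain K where K: "0 \<le> K" "\<And>x. x \<in> Y \<Longrightarrow> \<bar>f x\<bar> \<le> K * norm x"
    using subspace_dual_bounded[OF f] by blast
  \<comment> \<open>The two one-sided increments of \<open>p\<close> sum to more than
    \<open>\<epsilon> * norm w\<close>, while \<open>f w + f (- w) = 0\<close>; so one of them
    exceeds \<open>f\<close> by more than half of that.\<close>
  have "\<exists>v. (v = w \<or> v = - w) \<and> p h + f v + \<epsilon> / 2 * norm w < p (h + v)"
  proof (rule ccontr)
    assume "\<not> ?thesis"
    then have "p (h + w) \<le> p h + f w + \<epsilon> / 2 * norm w" "p (h - w) \<le> p h - f w + \<epsilon> / 2 * norm w"
      using f_uminus by (auto dest: spec[of _ w] spec[of _ "- w"])
    with d show False by simp
  qed
  then obtain v where v: "v \<in> Y" "norm v = norm w" "p h + f v + \<epsilon> / 2 * norm w < p (h + v)"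
    using Y(1,3) subspace_neg[OF Y(1,3)] norm_minus_cancel[of w] by blast
  define t where "t = L + K + \<epsilon> / 8"
  have "0 < t" using L(1) K(1) \<epsilon> by (simp add: t_def)
  \<comment> \<open>Moving from \<open>h + v\<close> to \<open>z\<close> costs \<open>L * r\<close>
    in \<open>p\<close>, \<open>K * r\<close> in \<open>f\<close> and
    \<open>\<epsilon> / 8 * r\<close> in the approximation. This \<open>r\<close> makes the total
    \<open>\<epsilon> / 8 * norm w\<close>; with the same amount for the approximation along
    \<open>v\<close>, it stays below the gap \<open>\<epsilon> / 2 * norm w\<close>.\<close>
  define r where "r = \<epsilon> / 8 * norm w / t"
  have r: "0 < r" "t * r = \<epsilon> / 8 * norm w" using \<open>0 < t\<close> \<epsilon> Y(4) by (simp_all add: r_def)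
  have "\<forall>z\<in>Y. norm (z - (h + v)) \<le> r \<longrightarrow> \<not> (\<exists>g. linear g \<and> (\<forall>x. g x \<le> p x) \<and> g z = p z \<and>
      (\<forall>x\<in>Y. \<bar>g x - f x\<bar> \<le> \<epsilon> / 8 * norm x))"
  proof (intro ballI impI notI, elim exE conjE)
    fix z g
    assume z: "z \<in> Y" "norm (z - (h + v)) \<le> r" and g: "linear g" "\<forall>x. g x \<le> p x" "g z = p z"
      and gf: "\<forall>x\<in>Y. \<bar>g x - f x\<bar> \<le> \<epsilon> / 8 * norm x"
    have mem: "z - h \<in> Y" "z - (h + v) \<in> Y" "h + v \<in> Y" using z Y v by (auto intro: subspace_diff subspace_add)
    have "p (h + v) \<le> p z + L * r"
      using sublinear_lipschitz[OF p L(2), of "h + v" z] mult_left_mono[OF z(2) L(1)]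
      by (simp add: norm_minus_commute)
    moreover have "p z - p h \<le> g (z - h)" using g(2)[rule_format, of h] g(3) linear_diff[OF g(1), of z h] by simp
    moreover have "g (z - h) \<le> f (z - h) + \<epsilon> / 8 * norm (z - h)" using bspec[OF gf mem(1)] by linarith
    moreover have "norm (z - h) \<le> r + norm w"
      using norm_triangle_ineq[of "z - (h + v)" v] z v by simp
    then have "\<epsilon> / 8 * norm (z - h) \<le> \<epsilon> / 8 * r + \<epsilon> / 8 * norm w"
      using \<epsilon> by (simp flip: distrib_left)
    moreover have "f (z - h) = f v + f (z - (h + v))"
      using f_add[of v "z - (h + v)"] v mem by (simp add: algebra_simps)
    moreover have "f (z - (h + v)) \<le> K * r"
      using K(2)[OF mem(2)] mult_left_mono[OF z(2) K(1)] by simp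
    ultimately have "p (h + v) \<le> p h + f v + (L * r + K * r + \<epsilon> / 8 * r) + \<epsilon> / 8 * norm w"
      by simp
    also have "L * r + K * r + \<epsilon> / 8 * r = \<epsilon> / 8 * norm w" using r(2) by (simp add: t_def algebra_simps)
    finally have "\<epsilon> / 2 * norm w < \<epsilon> / 8 * norm w + \<epsilon> / 8 * norm w" using v(3) by simp
    moreover have "0 < \<epsilon> * norm w" using \<epsilon> Y by simp
    ultimately show False by simp
  qed
  then show ?thesis using Y v r by (intro that[of "h + v" r]) (auto intro: subspace_add)
qed

text \<open>If every \<open>h\<close> had arbitrarily short directions of large second difference,
  the same would hold densely in a closed separable subspace. There the restricted subgradients of
  \<open>p\<close> are approximated by countably many functionals, and the sets \<open>E f\<close>
  of points served by one functional cover the subspace although their closures have no interior.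
  Where second differences are small, any support functional \<open>g\<close> at \<open>h\<close>
  gives the estimate, as \<open>p (h - w)\<close> is at least \<open>p h - g w\<close>.\<close>

theorem asplund_sublinear_almost_differentiable:
  fixes p :: "'a::banach \<Rightarrow> real"
  assumes X: "asplund TYPE('a)"
    and p: "sublinear p" and L: "0 \<le> L" "\<And>x. p x \<le> L * norm x" and \<epsilon>: "0 < \<epsilon>"
  shows "\<exists>h c xs. 0 < c \<and>
    (\<forall>w. norm w \<le> c \<longrightarrow> p (h + w) \<le> p h + blinfun_apply xs w + \<epsilon> * norm w)"
proof -
  have "\<exists>h c. 0 < c \<and> (\<forall>w. norm w \<le> c \<longrightarrow> p (h + w) + p (h - w) - 2 * p h \<le> \<epsilon> * norm w)"
  proof (rule ccontr)
    assume neg: "\<not> ?thesis"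
    have "\<exists>w. norm w = c \<and> \<epsilon> * norm w < p (h + w) + p (h - w) - 2 * p h" if c: "0 < c" for c h
    proof -
      obtain w where w: "norm w \<le> c" "\<epsilon> * norm w < p (h + w) + p (h - w) - 2 * p h"
        using neg c by (meson not_le)
      then have "w \<noteq> 0" by auto
      define s where "s = c / norm w"
      have s: "1 \<le> s" "s * norm w = c" using w \<open>w \<noteq> 0\<close> by (auto simp: s_def)
      have "\<epsilon> * (s * norm w) < s * (p (h + w) + p (h - w) - 2 * p h)"
        using mult_strict_left_mono[OF w(2), of s] s(1) by (simp add: mult_ac)
      also have "\<dots> \<le> p (h + s *\<^sub>R w) + p (h - s *\<^sub>R w) - 2 * p h"
        by (rule sublinear_second_difference[OF p s(1)])
      finally show ?thesis using s by (intro exI[of _ "s *\<^sub>R w"]) simp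
    qed
    then have "\<forall>h n. \<exists>w. norm w = inverse (real (Suc n)) \<and>
        \<epsilon> * norm w < p (h + w) + p (h - w) - 2 * p h"
      by simp
    then obtain W where W: "\<And>h n. norm (W h n) = inverse (real (Suc n))"
      "\<And>h n. \<epsilon> * norm (W h n) < p (h + W h n) + p (h - W h n) - 2 * p h"
      by metis
    \<comment> \<open>Closing under \<open>W\<close> keeps the bad directions of points of
      \<open>D\<close> inside \<open>Y\<close>; only points of \<open>D\<close> will be needed, as
      they are dense in \<open>Y\<close>.\<close>
    obtain D where D: "countable D" "0 \<in> D"
      "\<And>x y. x \<in> D \<Longrightarrow> y \<in> D \<Longrightarrow> x + y \<in> D" "\<And>r x. x \<in> D \<Longrightarrow> of_rat r *\<^sub>R x \<in> D"
      "\<And>x n. x \<in> D \<Longrightarrow> W x n \<in> D"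
      using countable_rational_hull[of W] by blast
    define Y where "Y = closure D"
    have DY: "D \<subseteq> Y" by (simp add: Y_def closure_subset)
    have Y: "subspace Y" unfolding Y_def by (intro subspace_closure_rational D)
    have "separable_space (top_of_set Y)"
      unfolding separable_space_def using D(1) DY
      by (intro exI[of _ D]) (auto simp: closure_of_subtopology Y_def Int_absorb1)
    then obtain F where F: "countable F" "F \<subseteq> subspace_dual Y"
      "\<And>f e. f \<in> subspace_dual Y \<Longrightarrow> 0 < e \<Longrightarrow> \<exists>g\<in>F. subspace_dual_norm Y (\<lambda>y. f y - g y) < e"
      using X Y unfolding asplund_def separable_dual_def by meson
    define E where "E f = {h \<in> Y. \<exists>g. linear g \<and> (\<forall>x. g x \<le> p x) \<and> g h = p h \<and>
      (\<forall>x\<in>Y. \<bar>g x - f x\<bar> \<le> \<epsilon> / 8 * norm x)}" for f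
    have EY: "closure (E f) \<subseteq> Y" for f
      unfolding Y_def by (intro closure_minimal) (auto simp: E_def Y_def)
    have "\<exists>f\<in>F. h \<in> E f" if h: "h \<in> Y" for h
    proof -
      obtain g where g: "linear g" "\<And>x. g x \<le> p x" "g h = p h" using sublinear_support[OF p] by blast
      define g' where "g' = (\<lambda>x. if x \<in> Y then g x else 0)"
      have g': "g' \<in> subspace_dual Y"
        unfolding g'_def using linear_le_sublinear_norm[OF g(1,2) L(2)] by (intro subspace_dual_restrict g Y)
      then obtain f where f: "f \<in> F" "subspace_dual_norm Y (\<lambda>y. g' y - f y) < \<epsilon> / 8"
        using F(3)[OF g', of "\<epsilon> / 8"] \<epsilon> by (meson divide_pos_pos zero_less_numeral)
      have "\<bar>g x - f x\<bar> \<le> \<epsilon> / 8 * norm x" if "x \<in> Y" for x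
      proof -
        have "\<bar>g' x - f x\<bar> \<le> subspace_dual_norm Y (\<lambda>y. g' y - f y) * norm x"
          using f(1) F(2) by (intro subspace_dual_norm_bound g' Y that) auto
        also have "\<dots> \<le> \<epsilon> / 8 * norm x" using f(2) by (intro mult_right_mono) auto
        finally show ?thesis using that by (simp add: g'_def)
      qed
      then have "h \<in> E f" using g h unfolding E_def by blast
      then show ?thesis using f(1) ..
    qed
    then have "Y \<subseteq> (\<Union>f\<in>F. E f)" by blast
    also have "\<dots> \<subseteq> (\<Union>f\<in>F. closure (E f))" by (intro UN_mono closure_subset) simp
    finally have "Y \<subseteq> (\<Union>f\<in>F. closure (E f))" .
    with EY have union: "(\<Union>f\<in>F. closure (E f)) = Y" by blast
    have "top_of_set Y interior_of \<Union>((\<lambda>f. closure (E f)) ` F) = {}"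
    proof (rule Baire_category_alt)
      have "completely_metrizable_space (top_of_set Y)"
        by (intro completely_metrizable_space_closedin completely_metrizable_space_euclidean)
          (simp add: Y_def)
      then show "completely_metrizable_space (top_of_set Y) \<or>
          locally_compact_space (top_of_set Y) \<and> regular_space (top_of_set Y)" ..
      show "countable ((\<lambda>f. closure (E f)) ` F)" using F(1) by simp
      fix T
      assume "T \<in> (\<lambda>f. closure (E f)) ` F"
      then obtain f where f: "f \<in> F" and T: "T = closure (E f)" by blast
      have "closedin (top_of_set Y) T" unfolding T by (intro closed_subset EY closed_closure)
      \<comment> \<open>Near \<open>h0\<close> there are \<open>h\<close> in \<open>D\<close> and a
        bad direction \<open>W h n\<close> so short that the resulting \<open>y\<close> stays in
        \<open>U\<close>. Then \<open>y\<close> is in \<open>closure (E f)\<close>, although a ball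
        around \<open>y\<close> in \<open>Y\<close> misses \<open>E f\<close>.\<close>
      moreover have False if U: "openin (top_of_set Y) U" "h0 \<in> U" "U \<subseteq> T" for U h0
      proof -
        have h0: "h0 \<in> Y" using openin_imp_subset[OF U(1)] U(2) by blast
        obtain e where e: "0 < e" "\<And>y. y \<in> Y \<Longrightarrow> dist y h0 < e \<Longrightarrow> y \<in> U"
          using U(1,2) unfolding openin_euclidean_subtopology_iff by meson
        obtain h where h: "h \<in> D" "dist h h0 < e / 2"
          using h0 half_gt_zero[OF e(1)] unfolding Y_def closure_approachable by blast
        obtain n where n: "inverse (real (Suc n)) < e / 2"
          using reals_Archimedean[of "e / 2"] e(1) by auto
        have w: "W h n \<in> Y" "W h n \<noteq> 0" using D(5)[OF h(1)] DY W(1)[of h n] by auto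
        obtain y r where y: "y \<in> Y" "norm (y - h) = norm (W h n)" "0 < r"
          and no: "\<forall>z\<in>Y. norm (z - y) \<le> r \<longrightarrow> \<not> (\<exists>g. linear g \<and> (\<forall>x. g x \<le> p x) \<and> g z = p z \<and>
            (\<forall>x\<in>Y. \<bar>g x - f x\<bar> \<le> \<epsilon> / 8 * norm x))"
          by (rule approximated_subgradients_nowhere_dense[OF p L \<epsilon> Y subsetD[OF DY h(1)] w
                subsetD[OF F(2) f] W(2)])
        have "dist y h0 < e"
          using dist_triangle[of y h0 h] y(2) h(2) n W(1)[of h n] by (simp add: dist_norm)
        then have "y \<in> closure (E f)" using e(2)[OF y(1)] U(3) T by blast
        then obtain z where z: "z \<in> E f" "dist z y < r"
          using y(3) unfolding closure_approachable by blast
        then have "norm (z - y) \<le> r" by (simp add: dist_norm)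
        moreover have "z \<in> Y" using z(1) by (simp add: E_def)
        ultimately have "\<not> (\<exists>g. linear g \<and> (\<forall>x. g x \<le> p x) \<and> g z = p z \<and>
            (\<forall>x\<in>Y. \<bar>g x - f x\<bar> \<le> \<epsilon> / 8 * norm x))"
          using no by simp
        with z(1) show False by (simp add: E_def)
      qed
      then have "top_of_set Y interior_of T = {}" by (subst interior_of_eq_empty) blast
      ultimately show "closedin (top_of_set Y) T \<and> top_of_set Y interior_of T = {}" ..
    qed
    moreover have "top_of_set Y interior_of Y = Y" using interior_of_topspace[of "top_of_set Y"] by simp
    ultimately have "Y = {}" using union by simp
    then show False using D(2) DY by auto
  qed
  then obtain h c where c: "0 < c"
    and hc: "\<And>w. norm w \<le> c \<Longrightarrow> p (h + w) + p (h - w) - 2 * p h \<le> \<epsilon> * norm w"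
    by blast
  obtain g where g: "linear g" "\<And>x. g x \<le> p x" "g h = p h" using sublinear_support[OF p] by blast
  have "norm (g x) \<le> norm x * L" for x
    using linear_le_sublinear_norm[OF g(1,2) L(2), of x] by (simp add: mult.commute)
  with g(1) have "bounded_linear g"
    unfolding bounded_linear_def bounded_linear_axioms_def by blast
  then have xs: "blinfun_apply (Blinfun g) = g" by (rule bounded_linear_Blinfun_apply)
  have "p (h + w) \<le> p h + blinfun_apply (Blinfun g) w + \<epsilon> * norm w" if "norm w \<le> c" for w
    using hc[OF that] g(2)[of "h - w"] g(3) linear_diff[OF g(1), of h w] by (simp add: xs)
  with c show ?thesis by blast
qed

subsection \<open>Subgradients of Lipschitz functions\<close>

text \<open>The lower-limit definition of a Frechet \<epsilon>-subgradient would give the inequality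
  only for each larger constant. Requiring it with \<open>e\<close> itself on a whole ball is
  slightly stronger and lets errors be added directly.\<close>

definition eps_subgradient ::
    "real \<Rightarrow> ('a::real_normed_vector \<Rightarrow> real) \<Rightarrow> 'a \<Rightarrow> ('a \<Rightarrow>\<^sub>L real) \<Rightarrow> bool" where
  "eps_subgradient e f x v \<longleftrightarrow>
     (\<exists>r>0. \<forall>u. norm u \<le> r \<longrightarrow> f x + blinfun_apply v u - e * norm u \<le> f (x + u))"

lemma eps_subgradientI:
  assumes "0 < r" "\<And>u. norm u \<le> r \<Longrightarrow> f x + blinfun_apply v u - e * norm u \<le> f (x + u)"
  shows "eps_subgradient e f x v"
  using assms unfolding eps_subgradient_def by blast

lemma eps_subgradientE:
  assumes "eps_subgradient e f x v"
  obtains r where "0 < r" "\<And>u. norm u \<le> r \<Longrightarrow> f x + blinfun_apply v u - e * norm u \<le> f (x + u)"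
  using assms that unfolding eps_subgradient_def by metis

lemma eps_subgradient_mono:
  assumes "eps_subgradient e f x v" "e \<le> e'"
  shows "eps_subgradient e' f x v"
proof -
  obtain r where r: "0 < r" "\<And>u. norm u \<le> r \<Longrightarrow> f x + blinfun_apply v u - e * norm u \<le> f (x + u)"
    using eps_subgradientE[OF assms(1)] by blast
  have "e * norm u \<le> e' * norm u" for u :: 'a using assms(2) by (simp add: mult_right_mono)
  then show ?thesis using r by (intro eps_subgradientI[OF r(1)]) (smt (verit))
qed

lemma lipschitz_UNIV_le:
  fixes f :: "'a::real_normed_vector \<Rightarrow> real"
  assumes "L-lipschitz_on UNIV f"
  shows "\<bar>f x - f y\<bar> \<le> L * norm (x - y)"
  using lipschitz_onD[OF assms, of x y] by (simp add: dist_norm)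

lemma lipschitz_UNIV_I:
  fixes f :: "'a::real_normed_vector \<Rightarrow> real"
  assumes "0 \<le> L" "\<And>x u. f (x + u) \<le> f x + L * norm u"
  shows "L-lipschitz_on UNIV f"
proof (rule lipschitz_onI)
  fix x y
  show "dist (f x) (f y) \<le> L * dist x y"
    using assms(2)[of x "y - x"] assms(2)[of y "x - y"]
    by (simp add: dist_norm norm_minus_commute)
qed (rule assms(1))

text \<open>The penalty \<open>2 * e * norm u\<close> leaves growth \<open>e\<close> over the
  approximate inequality, so the Ekeland point \<open>u0\<close> has norm at most
  \<open>r / 4\<close> and is interior; there the additive error has disappeared. The factor 3 is 2
  from the penalty and 1 from Ekeland's principle.\<close>

lemma eps_subgradient_rounding:
  fixes f :: "'a::banach \<Rightarrow> real"
  assumes f: "continuous_on UNIV f" and e: "0 < e" "0 < r" "4 * \<eta> \<le> e * r"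
    and approx: "\<And>u. norm u \<le> r \<Longrightarrow> f x + blinfun_apply v u - e * norm u - \<eta> \<le> f (x + u)"
  obtains y where "norm (y - x) \<le> \<eta> / e" "eps_subgradient (3 * e) f y v"
proof -
  define \<psi> where "\<psi> u = f (x + u) - blinfun_apply v u + 2 * e * norm u" for u
  have \<psi>_ge: "f x - \<eta> + e * norm u \<le> \<psi> u" if "norm u \<le> r" for u
    using approx[OF that] by (simp add: \<psi>_def)
  have "continuous_on (cball 0 r) \<psi>"
    unfolding \<psi>_def
    by (intro continuous_intros continuous_on_compose2[OF f]) auto
  moreover have "f x - \<eta> \<le> \<psi> u" if "u \<in> cball 0 r" for u
  proof -
    have "0 \<le> e * norm u" using e by simp
    then show ?thesis using \<psi>_ge[of u] that by simp
  qed
  ultimately obtain u0 where u0: "u0 \<in> cball 0 r" "\<psi> u0 + e * dist u0 0 \<le> \<psi> 0"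
    and min: "\<And>y. y \<in> cball 0 r \<Longrightarrow> \<psi> u0 - e * dist y u0 \<le> \<psi> y"
    using ekeland[of "cball 0 r" 0 \<psi> "f x - \<eta>" e] e by (auto simp: complete_eq_closed)
  have "2 * (e * norm u0) \<le> \<eta>" using u0 \<psi>_ge[of u0] by (simp add: \<psi>_def)
  moreover have "0 \<le> e * norm u0" using e by simp
  ultimately have u0_small: "e * norm u0 \<le> \<eta>" by linarith
  then have u0_le: "norm u0 \<le> \<eta> / e" using e by (simp add: field_simps)
  have "e * norm u0 \<le> e * (r / 4)" using u0_small e(3) by simp
  then have u0_r: "norm u0 \<le> r / 4" using e(1) by (simp only: mult_le_cancel_left_pos)
  have "eps_subgradient (3 * e) f (x + u0) v"
  proof (rule eps_subgradientI)
    show "0 < r / 2" using e by simp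
    fix w :: 'a
    assume w: "norm w \<le> r / 2"
    have "u0 + w \<in> cball 0 r" using norm_triangle_ineq[of u0 w] u0_r w e by simp
    from min[OF this] have "\<psi> u0 - e * norm w \<le> \<psi> (u0 + w)" by (simp add: dist_norm)
    moreover have "2 * e * norm (u0 + w) \<le> 2 * e * norm u0 + 2 * e * norm w"
      using norm_triangle_ineq[of u0 w] e by (simp flip: distrib_left)
    ultimately show "f (x + u0) + blinfun_apply v w - 3 * e * norm w \<le> f (x + u0 + w)"
      by (simp add: \<psi>_def blinfun.add_right add.assoc)
  qed
  then show ?thesis using that[of "x + u0"] u0_le by simp
qed

section \<open>Maximal slopes of a Lipschitz function on a ball\<close>

lemma increment_le_if_local:
  fixes \<phi> :: "real \<Rightarrow> real"
  assumes "0 < s" "0 < t"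
    and loc: "\<And>\<tau> \<sigma>. 0 \<le> \<tau> \<Longrightarrow> 0 < \<sigma> \<Longrightarrow> \<sigma> < s \<Longrightarrow> \<tau> + \<sigma> \<le> t \<Longrightarrow> \<phi> (\<tau> + \<sigma>) - \<phi> \<tau> \<le> C * \<sigma>"
  shows "\<phi> t - \<phi> 0 \<le> C * t"
proof -
  obtain n where n: "t / s < real n" using reals_Archimedean2 by blast
  moreover have "0 < t / s" using assms by simp
  ultimately have npos: "0 < real n" by linarith
  define \<sigma> where "\<sigma> = t / real n"
  have \<sigma>: "0 < \<sigma>" "\<sigma> < s" "real n * \<sigma> = t"
    using assms(1,2) n npos by (simp_all add: \<sigma>_def field_simps)
  have "\<phi> (real (Suc j) * \<sigma>) - \<phi> (real j * \<sigma>) \<le> C * \<sigma>" if "j < n" for j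
  proof -
    have "real j * \<sigma> + \<sigma> = real (Suc j) * \<sigma>" by (simp add: algebra_simps)
    also have "\<dots> \<le> real n * \<sigma>" using that \<sigma>(1) by (intro mult_right_mono) auto
    finally have "\<phi> (real j * \<sigma> + \<sigma>) - \<phi> (real j * \<sigma>) \<le> C * \<sigma>" using \<sigma> by (intro loc) auto
    then show ?thesis by (simp add: algebra_simps)
  qed
  then have "(\<Sum>j<n. \<phi> (real (Suc j) * \<sigma>) - \<phi> (real j * \<sigma>)) \<le> (\<Sum>j<n. C * \<sigma>)"
    by (intro sum_mono) simp
  then show ?thesis
    using \<sigma>(3) sum_lessThan_telescope[of "\<lambda>j. \<phi> (real j * \<sigma>)" n] by (simp add: mult_ac)
qed

lemma segment_in_cball:
  fixes y h :: "'a::real_normed_vector"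
  assumes "y \<in> cball x0 d" "y + s *\<^sub>R h \<in> cball x0 d" "0 \<le> \<tau>" "\<tau> \<le> s"
  shows "y + \<tau> *\<^sub>R h \<in> cball x0 d"
proof (cases "s = 0")
  case False
  then have s: "0 < s" using assms by simp
  have "(1 - \<tau> / s) *\<^sub>R y + (\<tau> / s) *\<^sub>R (y + s *\<^sub>R h) \<in> cball x0 d"
    using assms s by (intro convexD[OF convex_cball]) (auto simp: field_simps)
  also have "(1 - \<tau> / s) *\<^sub>R y + (\<tau> / s) *\<^sub>R (y + s *\<^sub>R h) = y + \<tau> *\<^sub>R h"
    using s by (simp add: algebra_simps)
  finally show ?thesis .
qed (use assms in auto)

text \<open>For Lipschitz \<open>f\<close> on a ball this is the supremum over the ball of Clarke's
  directional derivatives. Allowing steps of any length does not change the value, because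
  increments along a segment telescope.\<close>

definition max_slope :: "('a::real_normed_vector \<Rightarrow> real) \<Rightarrow> 'a set \<Rightarrow> 'a \<Rightarrow> real" where
  "max_slope f U h =
     (SUP (y, s)\<in>{(y, s). 0 < s \<and> y \<in> U \<and> y + s *\<^sub>R h \<in> U}. (f (y + s *\<^sub>R h) - f y) / s)"

context
  fixes f :: "'a::real_normed_vector \<Rightarrow> real" and L \<delta> :: real and x0 :: 'a
  assumes f: "L-lipschitz_on UNIV f" and \<delta>: "0 < \<delta>"
begin

private lemma slope_le: "0 < s \<Longrightarrow> (f (y + s *\<^sub>R h) - f y) / s \<le> L * norm h"
  using lipschitz_UNIV_le[OF f, of "y + s *\<^sub>R h" y] by (simp add: field_simps)

private lemma nonempty: "{(y, s). 0 < s \<and> y \<in> ball x0 \<delta> \<and> y + s *\<^sub>R h \<in> ball x0 \<delta>} \<noteq> {}"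
proof -
  have "norm ((\<delta> / (2 * (norm h + 1))) *\<^sub>R h) < \<delta>"
    using \<delta> by (simp add: field_simps add_pos_nonneg add_strict_increasing2)
  then have "(x0, \<delta> / (2 * (norm h + 1))) \<in> {(y, s). 0 < s \<and> y \<in> ball x0 \<delta> \<and> y + s *\<^sub>R h \<in> ball x0 \<delta>}"
    using \<delta> by (simp add: dist_norm add_nonneg_pos)
  then show ?thesis by blast
qed

lemma max_slope_upper:
  assumes "0 < s" "y \<in> ball x0 \<delta>" "y + s *\<^sub>R h \<in> ball x0 \<delta>"
  shows "f (y + s *\<^sub>R h) - f y \<le> s * max_slope f (ball x0 \<delta>) h"
proof -
  have "(f (y + s *\<^sub>R h) - f y) / s \<le> max_slope f (ball x0 \<delta>) h"
    unfolding max_slope_def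
    using assms slope_le by (intro cSUP_upper2[where x = "(y, s)"] bdd_aboveI2[where M = "L * norm h"]) auto
  then show ?thesis using assms(1) by (simp add: field_simps)
qed

lemma max_slope_least:
  assumes "\<And>y s. 0 < s \<Longrightarrow> y \<in> ball x0 \<delta> \<Longrightarrow> y + s *\<^sub>R h \<in> ball x0 \<delta> \<Longrightarrow> f (y + s *\<^sub>R h) - f y \<le> b * s"
  shows "max_slope f (ball x0 \<delta>) h \<le> b"
  unfolding max_slope_def using assms
  by (intro cSUP_least nonempty) (auto simp: field_simps)

lemma max_slope_norm_le: "max_slope f (ball x0 \<delta>) h \<le> L * norm h"
  using slope_le by (intro max_slope_least) (simp add: field_simps)

text \<open>Going along \<open>h\<close> first and along \<open>k\<close> second may leave the ball.
  But the segment stays at distance at least \<open>\<delta> - d\<close> from the boundary, so on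
  short pieces the detour remains inside, and the pieces are summed.\<close>

lemma sublinear_max_slope: "sublinear (max_slope f (ball x0 \<delta>))"
proof (rule sublinearI)
  let ?p = "max_slope f (ball x0 \<delta>)"
  fix h k
  show "?p (h + k) \<le> ?p h + ?p k"
  proof (rule max_slope_least)
    fix y s
    assume s: "0 < s" and y: "y \<in> ball x0 \<delta>" "y + s *\<^sub>R (h + k) \<in> ball x0 \<delta>"
    define d where "d = max (dist x0 y) (dist x0 (y + s *\<^sub>R (h + k)))"
    have d: "0 < \<delta> - d" using y by (simp add: d_def)
    have "f (y + s *\<^sub>R (h + k)) - f (y + 0 *\<^sub>R (h + k)) \<le> (?p h + ?p k) * s"
    proof (rule increment_le_if_local[of "(\<delta> - d) / (norm h + 1)" s "\<lambda>\<tau>. f (y + \<tau> *\<^sub>R (h + k))"])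
      show "0 < (\<delta> - d) / (norm h + 1)" using d by (simp add: add_nonneg_pos)
      fix \<tau> \<sigma> :: real
      assume \<tau>: "0 \<le> \<tau>" "0 < \<sigma>" "\<sigma> < (\<delta> - d) / (norm h + 1)" "\<tau> + \<sigma> \<le> s"
      define z where "z = y + \<tau> *\<^sub>R (h + k)"
      have eq: "y + (\<tau> + \<sigma>) *\<^sub>R (h + k) = z + \<sigma> *\<^sub>R h + \<sigma> *\<^sub>R k" by (simp add: z_def algebra_simps)
      have "y \<in> cball x0 d" "y + s *\<^sub>R (h + k) \<in> cball x0 d" by (simp_all add: d_def)
      then have z: "z \<in> cball x0 d" "y + (\<tau> + \<sigma>) *\<^sub>R (h + k) \<in> cball x0 d"
        unfolding z_def using \<tau> by (auto intro!: segment_in_cball[of y x0 d s] simp del: mem_cball)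
      have "\<sigma> * norm h \<le> \<sigma> * (norm h + 1)" using \<tau> by simp
      also have "\<dots> < \<delta> - d" using \<tau>(3) by (simp add: pos_less_divide_eq add_nonneg_pos)
      finally have "z + \<sigma> *\<^sub>R h \<in> ball x0 \<delta>"
        using z(1) dist_triangle[of x0 "z + \<sigma> *\<^sub>R h" z] \<tau>(2) by (simp add: dist_norm)
      moreover have "z \<in> ball x0 \<delta>" "z + \<sigma> *\<^sub>R h + \<sigma> *\<^sub>R k \<in> ball x0 \<delta>" using z d eq by auto
      ultimately show "f (y + (\<tau> + \<sigma>) *\<^sub>R (h + k)) - f (y + \<tau> *\<^sub>R (h + k)) \<le> (?p h + ?p k) * \<sigma>"
        using max_slope_upper[OF \<tau>(2), of z h] max_slope_upper[OF \<tau>(2), of "z + \<sigma> *\<^sub>R h" k]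
        unfolding eq by (simp add: z_def algebra_simps)
    qed (rule s)
    then show "f (y + s *\<^sub>R (h + k)) - f y \<le> (?p h + ?p k) * s" by simp
  qed
next
  fix c :: real and h
  assume c: "0 < c"
  show "max_slope f (ball x0 \<delta>) (c *\<^sub>R h) \<le> c * max_slope f (ball x0 \<delta>) h"
    using c max_slope_upper[of "_ * c" _ h] by (intro max_slope_least) (simp add: mult_ac)
next
  have "max_slope f (ball x0 \<delta>) 0 \<le> 0" by (rule max_slope_least) simp
  moreover have "0 \<le> max_slope f (ball x0 \<delta>) 0" using max_slope_upper[of 1 x0 0] \<delta> by simp
  ultimately show "max_slope f (ball x0 \<delta>) 0 = 0" by simp
qed

text \<open>If all short pieces of a nearly optimal segment had smaller slope, so would the whole
  segment. Hence a good piece can be short relative to its distance from the boundary. In the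
  application \<open>c\<close> is the radius of almost differentiability.\<close>

lemma max_slope_attained_locally:
  assumes \<beta>: "0 < \<beta>" and c: "0 < c"
  obtains y t where "0 < t" "cball y (c * t) \<subseteq> ball x0 \<delta>" "y + t *\<^sub>R h \<in> ball x0 \<delta>"
    "(max_slope f (ball x0 \<delta>) h - \<beta>) * t < f (y + t *\<^sub>R h) - f y"
proof -
  let ?b = "max_slope f (ball x0 \<delta>) h - \<beta>"
  obtain y s where s: "0 < s" and y: "y \<in> ball x0 \<delta>" "y + s *\<^sub>R h \<in> ball x0 \<delta>"
    and big: "?b * s < f (y + s *\<^sub>R h) - f y"
    using max_slope_least[of h ?b] \<beta> by force
  define d where "d = max (dist x0 y) (dist x0 (y + s *\<^sub>R h))"
  have d: "0 < \<delta> - d" using y by (simp add: d_def)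
  have "\<exists>\<tau> \<sigma>. 0 \<le> \<tau> \<and> 0 < \<sigma> \<and> \<sigma> < (\<delta> - d) / c \<and> \<tau> + \<sigma> \<le> s \<and>
    ?b * \<sigma> < f (y + (\<tau> + \<sigma>) *\<^sub>R h) - f (y + \<tau> *\<^sub>R h)"
  proof (rule ccontr)
    assume neg: "\<not> ?thesis"
    have "f (y + s *\<^sub>R h) - f (y + 0 *\<^sub>R h) \<le> ?b * s"
    proof (rule increment_le_if_local[of "(\<delta> - d) / c" s "\<lambda>\<tau>. f (y + \<tau> *\<^sub>R h)"])
      show "0 < (\<delta> - d) / c" using d c by simp
    qed (use neg s in \<open>meson not_le\<close>)+
    with big show False by simp
  qed
  then obtain \<tau> \<sigma> where \<tau>: "0 \<le> \<tau>" "0 < \<sigma>" "\<sigma> < (\<delta> - d) / c" "\<tau> + \<sigma> \<le> s"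
    and slope: "?b * \<sigma> < f (y + (\<tau> + \<sigma>) *\<^sub>R h) - f (y + \<tau> *\<^sub>R h)" by blast
  have "y \<in> cball x0 d" "y + s *\<^sub>R h \<in> cball x0 d" by (simp_all add: d_def)
  then have z: "y + \<tau> *\<^sub>R h \<in> cball x0 d" "y + (\<tau> + \<sigma>) *\<^sub>R h \<in> cball x0 d"
    using \<tau> by (auto intro!: segment_in_cball[of y x0 d s] simp del: mem_cball)
  have "c * \<sigma> < \<delta> - d" using \<tau>(3) c by (simp add: pos_less_divide_eq mult.commute)
  then have "cball (y + \<tau> *\<^sub>R h) (c * \<sigma>) \<subseteq> ball x0 \<delta>"
    using z(1) by (auto simp: subset_eq intro: order.strict_trans1[OF dist_triangle[of x0 _ "y + \<tau> *\<^sub>R h"]])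
  moreover have eq: "y + (\<tau> + \<sigma>) *\<^sub>R h = y + \<tau> *\<^sub>R h + \<sigma> *\<^sub>R h" by (simp add: algebra_simps)
  moreover have "y + (\<tau> + \<sigma>) *\<^sub>R h \<in> ball x0 \<delta>" using z(2) d by simp
  ultimately show ?thesis using slope \<tau>(2) unfolding eq by (intro that[of \<sigma> "y + \<tau> *\<^sub>R h"])
qed

end

text \<open>
  Let \<open>p\<close> be the maximal slope. If \<open>f\<close> climbs along \<open>t *\<^sub>R h\<close> at nearly the rate \<open>p h\<close>, then
  \<open>f (y + u) \<ge> f (y + t *\<^sub>R h) - p (t *\<^sub>R h - u)\<close>, and the upper estimate of \<open>p\<close> near a point
  of almost differentiability turns this into a lower estimate of \<open>f\<close> near \<open>y\<close>.
\<close>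

theorem lipschitz_dense_eps_subgradient:
  fixes f :: "'a::banach \<Rightarrow> real"
  assumes X: "asplund TYPE('a)" and f: "L-lipschitz_on UNIV f" and pos: "0 < e" "0 < \<delta>"
  obtains x v where "norm (x - x0) < \<delta>" "eps_subgradient e f x v"
proof -
  let ?U = "ball x0 \<delta>" and ?p = "max_slope f (ball x0 \<delta>)"
  have e3: "0 < e / 3" using pos by simp
  obtain h c xs where c: "0 < c"
    and diff: "\<And>w. norm w \<le> c \<Longrightarrow> ?p (h + w) \<le> ?p h + blinfun_apply xs w + e / 3 * norm w"
    using asplund_sublinear_almost_differentiable[OF X sublinear_max_slope[OF f pos(2)]
        lipschitz_on_nonneg[OF f] max_slope_norm_le[OF f pos(2)] e3] by blast
  \<comment> \<open>The loss in slope, times \<open>t\<close>, becomes the additive error in the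
    rounding with constant \<open>e / 3\<close> at radius \<open>c * t\<close>;
    \<open>e / 3 * c / 4\<close> is the largest loss that rounding admits.\<close>
  have \<beta>: "0 < e / 3 * c / 4" using e3 c by simp
  obtain y t where t: "0 < t" and y: "cball y (c * t) \<subseteq> ?U" "y + t *\<^sub>R h \<in> ?U"
    and slope: "(?p h - e / 3 * c / 4) * t < f (y + t *\<^sub>R h) - f y"
    by (rule max_slope_attained_locally[OF f pos(2) \<beta> c])
  have "f y + blinfun_apply xs u - e / 3 * norm u - e / 3 * c / 4 * t \<le> f (y + u)"
    if u: "norm u \<le> c * t" for u
  proof -
    have "y + u \<in> cball y (c * t)" using u by (simp add: dist_norm)
    with y(1) have "y + u \<in> ?U" ..
    then have "f (y + t *\<^sub>R h) - f (y + u) \<le> ?p (t *\<^sub>R h - u)"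
      using max_slope_upper[OF f pos(2), of 1 "y + u" x0 "t *\<^sub>R h - u"] y(2) by simp
    also have "t *\<^sub>R h - u = t *\<^sub>R (h + (- (1 / t) *\<^sub>R u))" using t by (simp add: algebra_simps)
    also have "?p \<dots> = t * ?p (h + (- (1 / t) *\<^sub>R u))"
      using t by (intro sublinear_scale[OF sublinear_max_slope[OF f pos(2)]]) simp
    also have "\<dots> \<le> t * (?p h + blinfun_apply xs (- (1 / t) *\<^sub>R u) + e / 3 * norm (- (1 / t) *\<^sub>R u))"
      using t u by (intro mult_left_mono diff) (auto simp: field_simps)
    also have "\<dots> = t * ?p h - blinfun_apply xs u + e / 3 * norm u"
      using t by (simp add: blinfun.scaleR_right blinfun.minus_right field_simps)
    finally show ?thesis using slope by (simp add: algebra_simps)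
  qed
  note approx = this
  have "0 < c * t" "4 * (e / 3 * c / 4 * t) \<le> e / 3 * (c * t)" using c t by simp_all
  then obtain x where x: "norm (x - y) \<le> (e / 3 * c / 4 * t) / (e / 3)"
    and sub: "eps_subgradient (3 * (e / 3)) f x xs"
    using eps_subgradient_rounding[OF lipschitz_on_continuous_on[OF f] e3 _ _ approx] by blast
  have "(e / 3 * c / 4 * t) / (e / 3) \<le> c * t" using pos(1) c t by simp
  with x have "x \<in> cball y (c * t)" by (simp add: dist_norm norm_minus_commute)
  with y(1) have "x \<in> ?U" ..
  then have "norm (x - x0) < \<delta>" by (simp add: dist_norm norm_minus_commute)
  then show ?thesis using that sub by simp
qed

subsection \<open>The fuzzy sum rule\<close>

text \<open>
  The infimum defining the marginal function \<open>q v = inf (f (x + v) + G x)\<close> may be estimated from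
  above by moving either argument, so a subgradient of \<open>q\<close> is at once one of \<open>f\<close> and, up to sign, one of \<open>G\<close>.
\<close>

lemma eps_subgradient_two:
  fixes f F :: "'a::banach \<Rightarrow> real"
  assumes X: "asplund TYPE('a)" and f: "L-lipschitz_on UNIV f" and F: "L'-lipschitz_on UNIV F"
    and \<sigma>: "0 \<le> \<sigma>" and sum: "eps_subgradient \<sigma> (\<lambda>x. f x + F x) x0 w"
    and pos: "0 < e" "0 < \<delta>"
  obtains x1 x2 v where "norm (x1 - x0) < \<delta>" "norm (x2 - x0) < \<delta>"
    "eps_subgradient e f x1 v" "eps_subgradient (\<sigma> + e) F x2 (w - v)"
proof -
  \<comment> \<open>Of the four parts, rounding uses three and the penalty in \<open>G\<close> uses
    one.\<close>
  define e' where "e' = e / 4"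
  have e': "0 < e'" "e = 4 * e'" using pos by (simp_all add: e'_def)
  have L: "0 \<le> L" by (rule lipschitz_on_nonneg[OF f])
  obtain R where R: "0 < R" "\<And>u. norm u \<le> R \<Longrightarrow>
      f x0 + F x0 + blinfun_apply w u - \<sigma> * norm u \<le> f (x0 + u) + F (x0 + u)"
    using eps_subgradientE[OF sum] by blast
  \<comment> \<open>Subtracting \<open>w\<close> and adding a penalty steeper than
    \<open>\<sigma>\<close> makes \<open>x0\<close> a minimizer of \<open>f + G\<close> on the ball
    with growth \<open>e'\<close>, which keeps near-minimizers close to it.\<close>
  define G where "G x = F x - blinfun_apply w x + (\<sigma> + e') * norm (x - x0)" for x
  have G_cont: "continuous_on UNIV G"
    unfolding G_def using lipschitz_on_continuous_on[OF F] by (intro continuous_intros)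
  have fG: "f x0 + G x0 + e' * norm (x - x0) \<le> f x + G x" if "x \<in> cball x0 R" for x
    using R(2)[of "x - x0"] that
    by (simp add: G_def dist_norm norm_minus_commute blinfun.diff_right algebra_simps)
  define q where "q v = (INF x\<in>cball x0 R. f (x + v) + G x)" for v
  have f_shift: "f (x + u) \<le> f x + L * norm u" "f x \<le> f (x + u) + L * norm u" for x u
    using lipschitz_UNIV_le[OF f, of "x + u" x] by auto
  have lower: "f x0 + G x0 - L * norm v \<le> f (x + v) + G x" if "x \<in> cball x0 R" for x v
  proof -
    have "0 \<le> e' * norm (x - x0)" using e' by simp
    then show ?thesis using fG[OF that] f_shift(2)[of x v] by linarith
  qed
  have q_le: "q v \<le> f (x + v) + G x" if "x \<in> cball x0 R" for x v
    unfolding q_def using that lower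
    by (intro cINF_lower bdd_belowI2[where m = "f x0 + G x0 - L * norm v"]) auto
  have q_ge: "b \<le> q v" if "\<And>x. x \<in> cball x0 R \<Longrightarrow> b \<le> f (x + v) + G x" for b v
    unfolding q_def using that R(1) by (intro cINF_greatest) auto
  have q_lip: "L-lipschitz_on UNIV q"
  proof (rule lipschitz_UNIV_I[OF L])
    fix v u
    have "q (v + u) - L * norm u \<le> q v"
    proof (rule q_ge)
      fix x
      assume "x \<in> cball x0 R"
      from q_le[OF this, of "v + u"] f_shift(1)[of "x + v" u]
      show "q (v + u) - L * norm u \<le> f (x + v) + G x" by (simp add: add.assoc)
    qed
    then show "q (v + u) \<le> q v + L * norm u" by simp
  qed
  define \<mu> where "\<mu> = min \<delta> R / 4"
  have \<mu>: "0 < \<mu>" "4 * \<mu> \<le> \<delta>" "4 * \<mu> \<le> R" using R(1) pos by (auto simp: \<mu>_def)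
  \<comment> \<open>The displacement \<open>v0\<close> is felt twice, each time by at most
    \<open>L * \<delta>' \<le> e' * \<mu> / 4\<close>; together with
    \<open>\<eta> \<le> e' * \<mu> / 2\<close> this places a near-minimizer within
    \<open>\<mu>\<close> of \<open>x0\<close>.\<close>
  define \<delta>' where "\<delta>' = min \<mu> (e' * \<mu> / (4 * (L + 1)))"
  have \<delta>': "0 < \<delta>'" "\<delta>' \<le> \<mu>" using \<mu> e' L by (auto simp: \<delta>'_def)
  have "L * \<delta>' \<le> (L + 1) * (e' * \<mu> / (4 * (L + 1)))"
    using L \<delta>' by (intro mult_mono) (auto simp: \<delta>'_def)
  also have "\<dots> = e' * \<mu> / 4" using L by (simp add: field_simps)
  finally have L\<delta>': "L * \<delta>' \<le> e' * \<mu> / 4" .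
  obtain v0 p where v0: "norm (v0 - 0) < \<delta>'" and "eps_subgradient e' q v0 p"
    by (rule lipschitz_dense_eps_subgradient[OF X q_lip e'(1) \<delta>'(1)])
  then obtain \<rho>0 where \<rho>0: "0 < \<rho>0"
    "\<And>u. norm u \<le> \<rho>0 \<Longrightarrow> q v0 + blinfun_apply p u - e' * norm u \<le> q (v0 + u)"
    using eps_subgradientE by metis
  define \<rho> where "\<rho> = min \<rho>0 (R / 2)"
  have \<rho>: "0 < \<rho>" "\<rho> \<le> \<rho>0" "\<rho> \<le> R / 2" using \<rho>0 R by (auto simp: \<rho>_def)
  define \<eta> where "\<eta> = min (e' * \<mu> / 2) (e' * \<rho> / 4)"
  have \<eta>: "0 < \<eta>" "\<eta> \<le> e' * \<mu> / 2" "4 * \<eta> \<le> e' * \<rho>" using e' \<mu> \<rho> by (auto simp: \<eta>_def)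
  have "\<eta> \<le> \<mu> * e'" using \<eta>(2) mult_pos_pos[OF \<mu>(1) e'(1)] by (simp add: mult.commute)
  then have \<eta>_e': "\<eta> / e' \<le> \<mu>" using e'(1) by (simp add: pos_divide_le_eq)
  have "\<exists>x\<in>cball x0 R. f (x + v0) + G x \<le> q v0 + \<eta>"
  proof (rule ccontr)
    assume "\<not> ?thesis"
    then have "q v0 + \<eta> \<le> q v0" by (intro q_ge) (auto simp: not_le intro: less_imp_le)
    with \<eta> show False by simp
  qed
  then obtain x where x: "x \<in> cball x0 R" "f (x + v0) + G x \<le> q v0 + \<eta>" by blast
  have "L * norm v0 \<le> L * \<delta>'" using v0 L by (intro mult_left_mono) auto
  then have "e' * norm (x - x0) \<le> e' * \<mu>"
    using fG[OF x(1)] f_shift(2)[of x v0] f_shift(1)[of x0 v0] q_le[of x0 v0] x(2) R(1) L\<delta>' \<eta>(2)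
    by simp
  then have x_near: "norm (x - x0) \<le> \<mu>" using e'(1) by (simp only: mult_le_cancel_left_pos)
  have approx_f: "f (x + v0) + blinfun_apply p u - e' * norm u - \<eta> \<le> f (x + v0 + u)"
    if "norm u \<le> \<rho>" for u
    using q_le[OF x(1), of "v0 + u"] \<rho>0(2)[of u] x(2) that \<rho>(2) by (simp add: add.assoc)
  obtain x1 where x1: "norm (x1 - (x + v0)) \<le> \<eta> / e'" "eps_subgradient (3 * e') f x1 p"
    by (rule eps_subgradient_rounding[OF lipschitz_on_continuous_on[OF f] e'(1) \<rho>(1) \<eta>(3) approx_f])
  have approx_G: "G x + blinfun_apply (- p) u - e' * norm u - \<eta> \<le> G (x + u)" if "norm u \<le> \<rho>" for u
  proof -
    have "norm (x + u - x0) \<le> R"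
      using norm_triangle_ineq[of "x - x0" u] x_near that \<mu> \<rho>(3) by (simp add: algebra_simps)
    then have "x + u \<in> cball x0 R" by (simp add: dist_norm norm_minus_commute)
    \<comment> \<open>Moving \<open>x\<close> to \<open>x + u\<close> and \<open>v0\<close> to
      \<open>v0 - u\<close> leaves the argument of \<open>f\<close> unchanged, so only
      \<open>G\<close> sees the change, and \<open>p\<close> changes sign.\<close>
    from q_le[OF this, of "v0 - u"] show ?thesis
      using \<rho>0(2)[of "- u"] x(2) that \<rho>(2) by (simp add: blinfun.minus_right blinfun.minus_left algebra_simps)
  qed
  obtain x2 where x2: "norm (x2 - x) \<le> \<eta> / e'" "eps_subgradient (3 * e') G x2 (- p)"
    by (rule eps_subgradient_rounding[OF G_cont e'(1) \<rho>(1) \<eta>(3) approx_G])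
  show ?thesis
  proof (rule that)
    show "norm (x1 - x0) < \<delta>"
      using norm_triangle_ineq[of "x1 - (x + v0)" "v0 + (x - x0)"] norm_triangle_ineq[of v0 "x - x0"]
        x1(1) \<eta>_e' x_near v0 \<delta>'(2) \<mu> by (simp add: algebra_simps)
    show "norm (x2 - x0) < \<delta>"
      using norm_triangle_ineq[of "x2 - x" "x - x0"] x2(1) \<eta>_e' x_near \<mu> by simp
    show "eps_subgradient e f x1 p" using x1(2) e' by (auto intro: eps_subgradient_mono)
    obtain s where s: "0 < s"
      "\<And>u. norm u \<le> s \<Longrightarrow> G x2 + blinfun_apply (- p) u - 3 * e' * norm u \<le> G (x2 + u)"
      using eps_subgradientE[OF x2(2)] by blast
    show "eps_subgradient (\<sigma> + e) F x2 (w - p)"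
    proof (rule eps_subgradientI[OF s(1)])
      fix u :: 'a
      assume u: "norm u \<le> s"
      have "(\<sigma> + e') * norm (x2 + u - x0) \<le> (\<sigma> + e') * (norm (x2 - x0) + norm u)"
        using norm_triangle_ineq[of "x2 - x0" u] \<sigma> e'
        by (intro mult_left_mono) (simp_all add: algebra_simps)
      with s(2)[OF u] show "F x2 + blinfun_apply (w - p) u - (\<sigma> + e) * norm u \<le> F (x2 + u)"
        by (simp add: G_def e'(2) blinfun.diff_left blinfun.minus_left blinfun.add_right algebra_simps)
    qed
  qed
qed

text \<open>Functions are split off one at a time. The error \<open>\<sigma>\<close> passes entirely
  to the remaining sum, which is treated at the new point \<open>x2\<close>, and each splitting
  spends half of what is left of \<open>e\<close> and \<open>\<delta>\<close>.\<close>

theorem eps_subgradient_sum: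
  fixes f :: "'i \<Rightarrow> 'a::banach \<Rightarrow> real"
  assumes X: "asplund TYPE('a)" and I: "finite I" "I \<noteq> {}"
    and f: "\<And>i. i \<in> I \<Longrightarrow> L-lipschitz_on UNIV (f i)"
    and \<sigma>: "0 \<le> \<sigma>" and sum: "eps_subgradient \<sigma> (\<lambda>x. \<Sum>i\<in>I. f i x) x0 w"
    and pos: "0 < e" "0 < \<delta>"
  shows "\<exists>x v. (\<forall>i\<in>I. norm (x i - x0) < \<delta> \<and> eps_subgradient (\<sigma> + e) (f i) (x i) (v i)) \<and>
    (\<Sum>i\<in>I. v i) = w"
  using I f \<sigma> sum pos
proof (induction I arbitrary: \<sigma> x0 w e \<delta> rule: finite_ne_induct)
  case (singleton i)
  have "eps_subgradient (\<sigma> + e) (f i) x0 w"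
    by (rule eps_subgradient_mono[of \<sigma>]) (use singleton in auto)
  then show ?case using singleton by (intro exI[of _ "\<lambda>_. x0"] exI[of _ "\<lambda>_. w"]) simp
next
  case (insert i I)
  let ?F = "\<lambda>x. \<Sum>i\<in>I. f i x"
  have F: "(\<Sum>i\<in>I. L)-lipschitz_on UNIV ?F"
  proof (rule lipschitz_UNIV_I)
    have "0 \<le> L" using insert.prems(1)[of i] lipschitz_on_nonneg by blast
    then show "0 \<le> (\<Sum>i\<in>I. L)" by (simp add: sum_nonneg)
    fix x u
    have "f j (x + u) \<le> f j x + L * norm u" if "j \<in> I" for j
      using lipschitz_UNIV_le[OF insert.prems(1)[of j], of "x + u" x] that by simp
    then have "?F (x + u) \<le> (\<Sum>j\<in>I. f j x + L * norm u)" by (rule sum_mono)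
    then show "?F (x + u) \<le> ?F x + (\<Sum>i\<in>I. L) * norm u" by (simp add: sum.distrib)
  qed
  have sum: "eps_subgradient \<sigma> (\<lambda>x. f i x + ?F x) x0 w" using insert by simp
  have fi: "L-lipschitz_on UNIV (f i)" using insert by simp
  have half: "0 < e / 2" "0 < \<delta> / 2" using insert by simp_all
  obtain x1 x2 v where x1: "norm (x1 - x0) < \<delta> / 2" "eps_subgradient (e / 2) (f i) x1 v"
    and x2: "norm (x2 - x0) < \<delta> / 2" "eps_subgradient (\<sigma> + e / 2) ?F x2 (w - v)"
    by (rule eps_subgradient_two[OF X fi F insert.prems(2) sum half])
  have eq: "(\<sigma> + e / 2) + e / 2 = \<sigma> + e" by simp
  have "\<exists>y u. (\<forall>i\<in>I. norm (y i - x2) < \<delta> / 2 \<and>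
      eps_subgradient ((\<sigma> + e / 2) + e / 2) (f i) (y i) (u i)) \<and> (\<Sum>i\<in>I. u i) = w - v"
    by (rule insert.IH) (use insert.prems x2 half in auto)
  then obtain y u where y: "\<And>j. j \<in> I \<Longrightarrow> norm (y j - x2) < \<delta> / 2"
    "\<And>j. j \<in> I \<Longrightarrow> eps_subgradient (\<sigma> + e) (f j) (y j) (u j)" "(\<Sum>i\<in>I. u i) = w - v"
    unfolding eq by blast
  have "norm (y j - x0) < \<delta>" if "j \<in> I" for j
    using norm_triangle_ineq[of "y j - x2" "x2 - x0"] y(1)[OF that] x2(1) by simp
  moreover have "norm (x1 - x0) < \<delta>" using x1(1) half by simp
  moreover have "eps_subgradient (\<sigma> + e) (f i) x1 v"
    by (rule eps_subgradient_mono[OF x1(2)]) (use insert.prems half in simp)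
  moreover have "(\<Sum>j\<in>I. (u(i := v)) j) = (\<Sum>j\<in>I. u j)" using insert.hyps by (intro sum.cong) auto
  then have "(\<Sum>j\<in>insert i I. (u(i := v)) j) = w" using insert.hyps y(3) by simp
  ultimately show ?case using insert.hyps y(2)
    by (intro exI[of _ "y(i := x1)"] exI[of _ "u(i := v)"] conjI) auto
qed

subsection \<open>Approximate and exact normals\<close>

lemma infdist_near_point:
  assumes "C \<noteq> {}" "0 < \<eta>"
  obtains z where "z \<in> C" "dist y z < infdist y C + \<eta>"
proof -
  have "(INF a\<in>C. dist y a) < infdist y C + \<eta>" using assms by (simp add: infdist_def)
  then show ?thesis using that assms(1) by (subst (asm) cINF_less_iff) auto
qed

text \<open>The error \<open>\<eta>\<close> accounts for almost nearest points. At distances small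
  against \<open>\<eta>\<close> the inequality says nothing, so it carries information only on a
  range of scales ending at \<open>r\<close>.\<close>

definition approx_normal ::
    "'a::real_normed_vector set \<Rightarrow> real \<Rightarrow> real \<Rightarrow> real \<Rightarrow> 'a \<Rightarrow> ('a \<Rightarrow>\<^sub>L real) \<Rightarrow> bool" where
  "approx_normal C e \<eta> r x v \<longleftrightarrow>
     x \<in> C \<and> (\<forall>z\<in>C. norm (z - x) \<le> r \<longrightarrow> blinfun_apply v (z - x) \<le> e * norm (z - x) + \<eta>)"

lemma approx_normalD:
  "approx_normal C e \<eta> r x v \<Longrightarrow> z \<in> C \<Longrightarrow> norm (z - x) \<le> r \<Longrightarrow>
    blinfun_apply v (z - x) \<le> e * norm (z - x) + \<eta>"
  by (simp add: approx_normal_def)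

text \<open>For \<open>x\<close> almost nearest to \<open>y\<close>, translating \<open>y\<close> by
  \<open>z - x\<close> leaves it at distance \<open>dist y x\<close> from \<open>z\<close>. The
  radius is chosen before \<open>\<eta>\<close>, so that the error can later be made small against
  it.\<close>

lemma eps_subgradient_infdist_approx_normal:
  assumes "C \<noteq> {}" "eps_subgradient e (\<lambda>x. infdist x C) y v"
  obtains r where "0 < r"
    "\<And>\<eta>. 0 < \<eta> \<Longrightarrow> \<exists>x. dist y x \<le> infdist y C + \<eta> \<and> approx_normal C e \<eta> r x v"
proof -
  obtain r where r: "0 < r"
    "\<And>u. norm u \<le> r \<Longrightarrow> infdist y C + blinfun_apply v u - e * norm u \<le> infdist (y + u) C"
    using eps_subgradientE[OF assms(2)] by blast
  show ?thesis
  proof (rule that[OF r(1)])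
    fix \<eta> :: real
    assume "0 < \<eta>"
    then obtain x where x: "x \<in> C" "dist y x < infdist y C + \<eta>"
      using infdist_near_point[OF assms(1)] by metis
    have "blinfun_apply v (z - x) \<le> e * norm (z - x) + \<eta>" if z: "z \<in> C" "norm (z - x) \<le> r" for z
    proof -
      have "infdist (y + (z - x)) C \<le> dist (y + (z - x)) z" by (rule infdist_le[OF z(1)])
      also have "\<dots> = dist y x" by (simp add: dist_norm)
      finally show ?thesis using r(2)[OF z(2)] x(2) by simp
    qed
    with x show "\<exists>x. dist y x \<le> infdist y C + \<eta> \<and> approx_normal C e \<eta> r x v"
      unfolding approx_normal_def by (intro exI[of _ x]) auto
  qed
qed

text \<open>Towards an almost nearest point the distance falls at nearly unit rate. One
  \<open>e\<close> is the error of the subgradient, the other the excess distance of that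
  point.\<close>

lemma eps_subgradient_infdist_norm_ge:
  assumes C: "C \<noteq> {}" and v: "eps_subgradient e (\<lambda>x. infdist x C) y v"
    and e: "0 < e" and d: "0 < infdist y C"
  shows "1 - 2 * e \<le> norm v"
proof -
  define d where "d = infdist y C"
  have "0 < d" using assms by (simp add: d_def)
  obtain r where r: "0 < r"
    "\<And>u. norm u \<le> r \<Longrightarrow> infdist y C + blinfun_apply v u - e * norm u \<le> infdist (y + u) C"
    using eps_subgradientE[OF v] by blast
  define s where "s = min 1 (r / (2 * d))"
  have s: "0 < s" "s \<le> 1" "s * (2 * d) \<le> r"
    using r(1) \<open>0 < d\<close> by (auto simp: s_def min_def field_simps)
  \<comment> \<open>The excess \<open>D - d\<close> must be small against the length
    \<open>s * D\<close> of the step actually taken, not only against \<open>d\<close>; hence the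
    factor \<open>s\<close>.\<close>
  have "0 < min d (e * s * d)" using \<open>0 < d\<close> e s by simp
  then obtain z where z: "z \<in> C" "dist y z < d + min d (e * s * d)"
    using infdist_near_point[OF C] unfolding d_def by metis
  define D where "D = dist y z"
  have D: "d \<le> D" "D \<le> 2 * d" "D - d \<le> e * s * d"
    using z infdist_le[OF z(1), of y] by (auto simp: D_def d_def)
  have norm: "norm (z - y) = D" by (simp add: D_def dist_norm norm_minus_commute)
  define u where "u = s *\<^sub>R (z - y)"
  have u: "norm u = s * D" using s by (simp add: u_def norm)
  have "s * D \<le> s * (2 * d)" using D s by (intro mult_left_mono) auto
  then have "d + blinfun_apply v u - e * (s * D) \<le> infdist (y + u) C"
    using r(2)[of u] s(3) u by (simp add: d_def)
  also have "\<dots> \<le> dist (y + u) z" by (rule infdist_le[OF z(1)])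
  also have "\<dots> = norm ((1 - s) *\<^sub>R (z - y))"
    by (simp add: dist_norm u_def norm_minus_commute algebra_simps)
  also have "\<dots> = (1 - s) * D" using s by (simp add: norm del: norm_scaleR add: norm_scaleR[unfolded real_norm_def])
  finally have "d + blinfun_apply v u - e * (s * D) \<le> (1 - s) * D" .
  moreover have "- (norm v * (s * D)) \<le> blinfun_apply v u"
    using norm_blinfun[of v u] by (simp add: u)
  moreover have "e * s * d \<le> e * s * D" using D s e by (intro mult_left_mono) auto
  ultimately have "(s * D) * (1 - 2 * e) \<le> (s * D) * norm v" using D(3) by (simp add: algebra_simps)
  moreover have "0 < s * D" using s D \<open>0 < d\<close> by simp
  ultimately show ?thesis by (simp only: mult_le_cancel_left_pos)
qed

lemma norm_blinfun_le_if_local: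
  fixes f :: "'a::real_normed_vector \<Rightarrow>\<^sub>L real"
  assumes "0 < r" "0 \<le> k" and loc: "\<And>u. norm u \<le> r \<Longrightarrow> blinfun_apply f u \<le> k * norm u"
  shows "norm f \<le> k"
proof (rule norm_blinfun_bound[OF assms(2)])
  have le: "blinfun_apply f x \<le> k * norm x" for x
  proof (cases "x = 0")
    case False
    define c where "c = r / norm x"
    have c: "0 < c" "norm (c *\<^sub>R x) \<le> r" using False assms(1) by (simp_all add: c_def)
    have "c * blinfun_apply f x \<le> c * (k * norm x)"
      using loc[OF c(2)] c(1) by (simp add: blinfun.scaleR_right mult_ac)
    then show ?thesis using c(1) by (simp only: mult_le_cancel_left_pos)
  qed simp
  show "norm (blinfun_apply f x) \<le> k * norm x" for x
    using le[of x] le[of "- x"] by (simp add: blinfun.minus_right abs_le_iff)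
qed

text \<open>
  Here the marginal function is \<open>q u = inf (g (z + u))\<close> over \<open>z\<close> in \<open>C\<close>, where \<open>g\<close> is \<open>- v\<close> plus a multiple of
  the distance to \<open>x\<close>. The last conclusion, at a scale unrelated to \<open>s\<close>, comes from Ekeland's
  principle; without it there would be a gap between the scales \<open>s\<close> and \<open>r\<close>.
\<close>

lemma approx_normal_refine:
  fixes C :: "'a::banach set"
  assumes X: "asplund TYPE('a)" and C: "closed C"
    and pos: "0 < e" "0 < r" "0 < \<eta>" "4 * \<eta> \<le> e * r" "0 < \<kappa>"
    and v: "approx_normal C e \<eta> r x v"
  obtains y w s where "0 < s" "s \<le> r / 2" "approx_normal C (e / 2) (\<kappa> * s) s y w"
    "norm (y - x) \<le> 2 * \<eta> / e" "norm (w - v) \<le> 3 * e"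
    "\<forall>z\<in>C. norm (z - y) \<le> r / 2 \<longrightarrow> blinfun_apply v (z - y) \<le> 3 * e * norm (z - y)"
proof -
  define C' where "C' = C \<inter> cball x r"
  have C': "complete C'" using C by (simp add: C'_def complete_eq_closed closed_Int)
  have x: "x \<in> C'" using v pos by (simp add: C'_def approx_normal_def)
  \<comment> \<open>One \<open>e\<close> of the penalty offsets the error in the normal inequality,
    the other gives growth away from \<open>x\<close>.\<close>
  define g where "g y = 2 * e * norm (y - x) - blinfun_apply v y" for y
  define L where "L = norm v + 2 * e"
  have L: "0 < L" using pos by (simp add: L_def add_nonneg_pos)
  have g_shift: "g (y + u) \<le> g y - blinfun_apply v u + 2 * e * norm u"
    and g_shift': "g (y + u) \<le> g y + L * norm u" for y u
  proof -
    have "2 * e * norm (y + u - x) \<le> 2 * e * (norm (y - x) + norm u)"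
      using norm_triangle_ineq[of "y - x" u] pos(1)
      by (intro mult_left_mono) (simp_all add: algebra_simps)
    then show *: "g (y + u) \<le> g y - blinfun_apply v u + 2 * e * norm u"
      by (simp add: g_def blinfun.add_right algebra_simps)
    have "- blinfun_apply v u \<le> norm v * norm u" using norm_blinfun[of v u] by simp
    with * show "g (y + u) \<le> g y + L * norm u" by (simp add: L_def algebra_simps)
  qed
  have g_ge: "g x - \<eta> + e * norm (z - x) \<le> g z" if "z \<in> C'" for z
    using approx_normalD[OF v, of z] that
    by (simp add: g_def C'_def dist_norm norm_minus_commute blinfun.diff_right)
  define q where "q u = (INF z\<in>C'. g (z + u))" for u
  have lower: "g x - \<eta> - L * norm u \<le> g (z + u)" if "z \<in> C'" for z u
  proof -
    have "0 \<le> e * norm (z - x)" using pos by simp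
    then show ?thesis using g_ge[OF that] g_shift'[of "z + u" "- u"] by simp
  qed
  have q_le: "q u \<le> g (z + u)" if "z \<in> C'" for z u
    unfolding q_def using that lower
    by (intro cINF_lower bdd_belowI2[where m = "g x - \<eta> - L * norm u"]) auto
  have q_ge: "b \<le> q u" if "\<And>z. z \<in> C' \<Longrightarrow> b \<le> g (z + u)" for b u
    unfolding q_def using that x by (intro cINF_greatest) auto
  have q_shift: "q (u + w) \<le> q u - blinfun_apply v w + 2 * e * norm w" for u w
  proof -
    have "q (u + w) + blinfun_apply v w - 2 * e * norm w \<le> q u"
    proof (rule q_ge)
      fix z
      assume "z \<in> C'"
      from q_le[OF this, of "u + w"] g_shift[of "z + u" w]
      show "q (u + w) + blinfun_apply v w - 2 * e * norm w \<le> g (z + u)" by (simp add: add.assoc)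
    qed
    then show ?thesis by simp
  qed
  have q_lip: "L-lipschitz_on UNIV q"
  proof (rule lipschitz_UNIV_I)
    fix u w
    have "- blinfun_apply v w \<le> norm v * norm w" using norm_blinfun[of v w] by simp
    then show "q (u + w) \<le> q u + L * norm w" using q_shift[of u w] by (simp add: L_def algebra_simps)
  qed (use L in simp)
  \<comment> \<open>The displacement costs \<open>L * \<delta>\<close> twice, that is
    \<open>\<eta> / 2\<close>; with \<open>\<eta>' \<le> \<eta> / 2\<close> and the
    \<open>\<eta>\<close> of the hypothesis this gives
    \<open>e * norm (y - x) \<le> 2 * \<eta>\<close>.\<close>
  define \<delta> where "\<delta> = \<eta> / (4 * L)"
  have \<delta>: "0 < \<delta>" "L * \<delta> = \<eta> / 4" using L pos by (simp_all add: \<delta>_def)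
  have "0 < e / 2" using pos by simp
  then obtain u0 p where u0: "norm (u0 - 0) < \<delta>" and "eps_subgradient (e / 2) q u0 p"
    using lipschitz_dense_eps_subgradient[OF X q_lip _ \<delta>(1)] by metis
  then obtain \<rho> where \<rho>: "0 < \<rho>"
    "\<And>u. norm u \<le> \<rho> \<Longrightarrow> q u0 + blinfun_apply p u - e / 2 * norm u \<le> q (u0 + u)"
    using eps_subgradientE by metis
  define s where "s = min \<rho> (r / 2)"
  have s: "0 < s" "s \<le> \<rho>" "s \<le> r / 2" using \<rho> pos by (auto simp: s_def)
  \<comment> \<open>Chosen only after the radius \<open>\<rho>\<close> is known: the new error is
    \<open>\<kappa>\<close> times the new scale, however small that scale turned out to be.\<close>
  define \<eta>' where "\<eta>' = min (\<eta> / 2) (\<kappa> * s)"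
  have \<eta>': "0 < \<eta>'" "\<eta>' \<le> \<eta> / 2" "\<eta>' \<le> \<kappa> * s" using pos s by (auto simp: \<eta>'_def)
  have "\<exists>z\<in>C'. g (z + u0) \<le> q u0 + \<eta>'"
  proof (rule ccontr)
    assume "\<not> ?thesis"
    then have "q u0 + \<eta>' \<le> q u0" by (intro q_ge) (auto simp: not_le intro: less_imp_le)
    with \<eta>' show False by simp
  qed
  then obtain z0 where z0: "z0 \<in> C'" "g (z0 + u0) \<le> q u0 + \<eta>'" by blast
  have g_cont: "continuous_on C' (\<lambda>z. g (z + u0))" unfolding g_def by (intro continuous_intros)
  obtain y where y: "y \<in> C'" "g (y + u0) + e * dist y z0 \<le> g (z0 + u0)"
    and min: "\<And>z. z \<in> C' \<Longrightarrow> g (y + u0) - e * dist z y \<le> g (z + u0)"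
    using ekeland[OF C' z0(1) g_cont q_le pos(1)] by blast
  have "0 \<le> e * dist y z0" using pos by simp
  then have yq: "g (y + u0) \<le> q u0 + \<eta>'" using y(2) z0(2) by linarith
  have "L * norm u0 \<le> L * \<delta>" using u0 L by (intro mult_left_mono) auto
  then have "e * norm (y - x) \<le> 2 * \<eta>"
    using g_ge[OF y(1)] g_shift'[of "y + u0" "- u0"] yq q_le[OF x, of u0] g_shift'[of x u0] \<delta>(2) \<eta>'(2)
    by simp
  then have yx: "norm (y - x) \<le> 2 * \<eta> / e" using pos by (simp add: pos_le_divide_eq mult.commute)
  also have "\<dots> \<le> r / 2" using pos by (simp add: pos_divide_le_eq mult.commute)
  finally have yr: "norm (y - x) \<le> r / 2" .
  have inC': "z \<in> C'" if "z \<in> C" "norm (z - y) \<le> r / 2" for z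
    using norm_triangle_ineq[of "z - y" "y - x"] yr that
    by (simp add: C'_def dist_norm norm_minus_commute[of x])
  show ?thesis
  proof (rule that[OF s(1) s(3) _ yx])
    show "approx_normal C (e / 2) (\<kappa> * s) s y (- p)"
      unfolding approx_normal_def
    proof (intro conjI ballI impI)
      show "y \<in> C" using y by (simp add: C'_def)
      fix z
      assume z: "z \<in> C" "norm (z - y) \<le> s"
      then have "z \<in> C'" using s by (intro inC') auto
      \<comment> \<open>The extra displacement \<open>y - z\<close> carries \<open>z\<close> to
        \<open>y\<close>, so \<open>q\<close> there is at most the value at
        \<open>y + u0\<close>.\<close>
      from q_le[OF this, of "u0 + (y - z)"] have "q (u0 + (y - z)) \<le> g (y + u0)"
        by (simp add: add.commute)
      with \<rho>(2)[of "y - z"] z(2) s(2) yq \<eta>'(3)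
      show "blinfun_apply (- p) (z - y) \<le> e / 2 * norm (z - y) + \<kappa> * s"
        by (simp add: blinfun.minus_left blinfun.diff_right norm_minus_commute)
    qed
    \<comment> \<open>The increment of \<open>q\<close> is bounded above by \<open>- v\<close> with
      error \<open>2 * e\<close> and below by \<open>p\<close> with error
      \<open>e / 2\<close>.\<close>
    have "norm (p + v) \<le> 3 * e"
    proof (rule norm_blinfun_le_if_local[OF \<rho>(1)])
      fix u :: 'a
      assume "norm u \<le> \<rho>"
      then have "q u0 + blinfun_apply p u - e / 2 * norm u \<le> q (u0 + u)" by (rule \<rho>(2))
      moreover have "0 \<le> e * norm u" using pos by simp
      ultimately show "blinfun_apply (p + v) u \<le> 3 * e * norm u"
        using q_shift[of u0 u] by (simp add: blinfun.add_left)
    qed (use pos in simp)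
    then show "norm (- p - v) \<le> 3 * e" by (metis minus_add_distrib norm_minus_cancel uminus_add_conv_diff add.commute)
    show "\<forall>z\<in>C. norm (z - y) \<le> r / 2 \<longrightarrow> blinfun_apply v (z - y) \<le> 3 * e * norm (z - y)"
    proof (intro ballI impI)
      fix z
      assume z: "z \<in> C" "norm (z - y) \<le> r / 2"
      from min[OF inC'[OF z]] g_shift[of "y + u0" "z - y"]
      show "blinfun_apply v (z - y) \<le> 3 * e * norm (z - y)"
        by (simp add: dist_norm algebra_simps)
    qed
  qed
qed

section \<open>Exact Frechet normals as limits of approximate ones\<close>

lemma convergent_if_telescoping:
  fixes a :: "nat \<Rightarrow> 'a::banach"
  assumes step: "\<And>n. norm (a (Suc n) - a n) \<le> t n - t (Suc n)" and t: "t \<longlonglongrightarrow> 0"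
  obtains l where "a \<longlonglongrightarrow> l" "\<forall>n. norm (l - a n) \<le> t n"
proof -
  have tele: "norm (a (n + k) - a n) \<le> t n - t (n + k)" for n k
  proof (induction k)
    case (Suc k)
    then show ?case
      using step[of "n + k"] norm_triangle_ineq[of "a (Suc (n + k)) - a (n + k)" "a (n + k) - a n"]
      by simp
  qed simp
  have nonneg: "0 \<le> t n" for n
  proof -
    have "decseq t" using step by (intro decseq_SucI) (metis diff_ge_0_iff_ge norm_ge_zero order_trans)
    then show ?thesis using t by (simp add: decseq_ge)
  qed
  have bound: "norm (a (n + k) - a n) \<le> t n" for n k
    using tele[of n k] nonneg[of "n + k"] by simp
  have "Cauchy a"
  proof (rule metric_CauchyI)
    fix e :: real
    assume "0 < e"
    then have "eventually (\<lambda>n. t n < e / 2) sequentially"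
      using order_tendstoD(2)[OF t, of "e / 2"] by simp
    then obtain N where N: "t N < e / 2" by (auto simp: eventually_sequentially)
    have "dist (a n) (a N) < e / 2" if "N \<le> n" for n
      using bound[of N "n - N"] that N by (simp add: dist_norm)
    then show "\<exists>N. \<forall>m\<ge>N. \<forall>n\<ge>N. dist (a m) (a n) < e" by (meson dist_triangle_half_l dist_commute)
  qed
  then obtain l where l: "a \<longlonglongrightarrow> l" using Cauchy_convergent_iff convergent_def by blast
  have "norm (l - a n) \<le> t n" for n
  proof (rule LIMSEQ_le_const2)
    show "(\<lambda>k. norm (a (k + n) - a n)) \<longlonglongrightarrow> norm (l - a n)"
      using LIMSEQ_ignore_initial_segment[OF l] by (intro tendsto_intros)
    show "\<exists>N. \<forall>k\<ge>N. norm (a (k + n) - a n) \<le> t n" using bound[of n] by (auto simp: add.commute)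
  qed
  with l that show ?thesis by blast
qed

text \<open>The edge cases agree: the filter omits \<open>z = x\<close>, where the inequality is
  trivial, and at an isolated point both conditions hold for every functional.\<close>

lemma frechet_normal_cone_iff:
  "v \<in> frechet_normal_cone x S \<longleftrightarrow> x \<in> S \<and>
     (\<forall>e>0. \<exists>d>0. \<forall>z\<in>S. norm (z - x) < d \<longrightarrow> blinfun_apply v (z - x) \<le> e * norm (z - x))"
proof -
  have "Limsup (at x within S) (\<lambda>u. ereal (blinfun_apply v (u - x) / norm (u - x))) \<le> 0 \<longleftrightarrow>
      (\<forall>e>0. \<exists>d>0. \<forall>z\<in>S. norm (z - x) < d \<longrightarrow> blinfun_apply v (z - x) \<le> e * norm (z - x))"
    (is "?l \<longleftrightarrow> ?r")
  proof
    assume l: ?l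
    show ?r
    proof (intro allI impI)
      fix e :: real
      assume e: "0 < e"
      then have "(0::ereal) < ereal e" by simp
      with l have "eventually (\<lambda>u. ereal (blinfun_apply v (u - x) / norm (u - x)) < ereal e) (at x within S)"
        unfolding Limsup_le_iff by blast
      then obtain d where d: "0 < d" "\<And>z. z \<in> S \<Longrightarrow> z \<noteq> x \<Longrightarrow> dist z x < d \<Longrightarrow>
          blinfun_apply v (z - x) / norm (z - x) < e"
        unfolding eventually_at by auto
      have "blinfun_apply v (z - x) \<le> e * norm (z - x)" if "z \<in> S" "norm (z - x) < d" for z
        using d(2)[of z] that by (cases "z = x") (auto simp: dist_norm pos_divide_less_eq)
      with d(1) show "\<exists>d>0. \<forall>z\<in>S. norm (z - x) < d \<longrightarrow> blinfun_apply v (z - x) \<le> e * norm (z - x)"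
        by blast
    qed
  next
    assume r: ?r
    show ?l
      unfolding Limsup_le_iff
    proof (intro allI impI)
      fix y :: ereal
      assume "0 < y"
      then obtain e where e: "0 < e" "ereal e < y"
        using ereal_dense2[of 0 y] by (auto simp: zero_ereal_def)
      obtain d where d: "0 < d"
        "\<And>z. z \<in> S \<Longrightarrow> norm (z - x) < d \<Longrightarrow> blinfun_apply v (z - x) \<le> e * norm (z - x)"
        using r e(1) by blast
      have "ereal (blinfun_apply v (z - x) / norm (z - x)) < y"
        if z: "z \<in> S" "z \<noteq> x" "dist z x < d" for z
      proof -
        have "blinfun_apply v (z - x) / norm (z - x) \<le> e"
          using d(2)[of z] z by (simp add: dist_norm pos_divide_le_eq)
        then have "ereal (blinfun_apply v (z - x) / norm (z - x)) \<le> ereal e" by simp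
        from this e(2) show ?thesis by (rule le_less_trans)
      qed
      with d(1) show "eventually (\<lambda>u. ereal (blinfun_apply v (u - x) / norm (u - x)) < y) (at x within S)"
        unfolding eventually_at by blast
    qed
  qed
  then show ?thesis by (simp add: frechet_normal_cone_def)
qed

lemma frechet_normal_cone_scaleR:
  assumes "v \<in> frechet_normal_cone x S" "0 < c"
  shows "c *\<^sub>R v \<in> frechet_normal_cone x S"
  unfolding frechet_normal_cone_iff
proof (intro conjI allI impI)
  show "x \<in> S" using assms by (simp add: frechet_normal_cone_iff)
  fix e :: real
  assume "0 < e"
  then have "0 < e / c" using assms by simp
  then obtain d where d: "0 < d"
    "\<And>z. z \<in> S \<Longrightarrow> norm (z - x) < d \<Longrightarrow> blinfun_apply v (z - x) \<le> e / c * norm (z - x)"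
    using assms(1) unfolding frechet_normal_cone_iff by meson
  have "blinfun_apply (c *\<^sub>R v) (z - x) \<le> e * norm (z - x)" if "z \<in> S" "norm (z - x) < d" for z
    using mult_left_mono[OF d(2)[OF that], of c] assms(2) by (simp add: blinfun.scaleR_left)
  with d(1) show "\<exists>d>0. \<forall>z\<in>S. norm (z - x) < d \<longrightarrow> blinfun_apply (c *\<^sub>R v) (z - x) \<le> e * norm (z - x)"
    by blast
qed

lemma frechet_normal_cone_local:
  assumes v: "v \<in> frechet_normal_cone x (S \<inter> cball x0 r)" and x: "dist x0 x < r"
  shows "v \<in> frechet_normal_cone x S"
  unfolding frechet_normal_cone_iff
proof (intro conjI allI impI)
  show "x \<in> S" using v by (simp add: frechet_normal_cone_iff)
  fix e :: real
  assume "0 < e"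
  then obtain d where d: "0 < d" "\<And>z. z \<in> S \<inter> cball x0 r \<Longrightarrow> norm (z - x) < d \<Longrightarrow>
      blinfun_apply v (z - x) \<le> e * norm (z - x)"
    using v unfolding frechet_normal_cone_iff by meson
  have "blinfun_apply v (z - x) \<le> e * norm (z - x)"
    if z: "z \<in> S" "norm (z - x) < min d (r - dist x0 x)" for z
  proof -
    have "dist x0 z \<le> r" using dist_triangle[of x0 z x] z(2) by (simp add: dist_norm norm_minus_commute)
    then show ?thesis using d(2)[of z] z by simp
  qed
  moreover have "0 < min d (r - dist x0 x)" using d(1) x by simp
  ultimately show "\<exists>d>0. \<forall>z\<in>S. norm (z - x) < d \<longrightarrow> blinfun_apply v (z - x) \<le> e * norm (z - x)"
    by blast
qed

text \<open>The radii \<open>rs n\<close> at least halve but may collapse much faster. For distances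
  from the limit point between \<open>rs (Suc n) / 4\<close> and \<open>rs n / 4\<close>, the slope
  bound for \<open>vs n\<close> is used, and \<open>w\<close> is within
  \<open>6 * \<epsilon> n\<close> of \<open>vs n\<close>. As the radii tend to zero, these ranges
  exhaust all small distances.\<close>

theorem frechet_normal_near_approx_normal:
  fixes C :: "'a::banach set"
  assumes X: "asplund TYPE('a)" and C: "closed C"
    and e: "0 < e" "e \<le> 1" and r: "0 < r"
    and v: "approx_normal C e (e\<^sup>2 * r / (16 * (norm v + 10))) r x v"
  obtains y w where "w \<in> frechet_normal_cone y C" "norm (y - x) \<le> r" "norm (w - v) \<le> 6 * e"
proof -
  \<comment> \<open>Since \<open>norm (vs n) \<le> norm v + 12\<close> throughout,
    \<open>norm (vs n) + 3 * \<epsilon> n\<close> stays below \<open>K / 8\<close>. Replacing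
    \<open>xs (Suc n)\<close> by the limit \<open>y\<close> then costs at most
    \<open>\<epsilon> n * norm (z - y)\<close> at the distances considered in
    \<open>key\<close>.\<close>
  define K where "K = 16 * (norm v + 10)"
  have K: "160 \<le> K" by (simp add: K_def)
  define \<epsilon> where "\<epsilon> n = e / 2 ^ n" for n :: nat
  have \<epsilon>: "0 < \<epsilon> n" "\<epsilon> n \<le> 1" "\<epsilon> (Suc n) = \<epsilon> n / 2" for n
  proof -
    have "e / 2 ^ n \<le> 1" using e by (simp add: divide_le_eq order_trans[of e 1])
    then show "0 < \<epsilon> n" "\<epsilon> n \<le> 1" "\<epsilon> (Suc n) = \<epsilon> n / 2" using e by (simp_all add: \<epsilon>_def)
  qed
  \<comment> \<open>The clause for \<open>n = 0\<close> pins the start of the sequence, which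
    dependent choice would leave free.\<close>
  define P where "P n a \<longleftrightarrow> (case a of (x', v', r') \<Rightarrow> 0 < r' \<and>
      approx_normal C (\<epsilon> n) ((\<epsilon> n)\<^sup>2 * r' / K) r' x' v' \<and> (n = 0 \<longrightarrow> a = (x, v, r)))"
    for n and a :: "'a \<times> ('a \<Rightarrow>\<^sub>L real) \<times> real"
  define Q where "Q n a b \<longleftrightarrow> (case a of (x', v', r') \<Rightarrow> case b of (y, w, s) \<Rightarrow>
      s \<le> r' / 2 \<and> norm (y - x') \<le> 2 * \<epsilon> n * r' / K \<and> norm (w - v') \<le> 3 * \<epsilon> n \<and>
      (\<forall>z\<in>C. norm (z - y) \<le> r' / 2 \<longrightarrow> blinfun_apply v' (z - y) \<le> 3 * \<epsilon> n * norm (z - y)))"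
    for n and a b :: "'a \<times> ('a \<Rightarrow>\<^sub>L real) \<times> real"
  have "\<exists>b. P (Suc n) b \<and> Q n a b" if "P n a" for n a
  proof -
    obtain x' v' r' where a: "a = (x', v', r')" by (cases a)
    have r': "0 < r'" and v': "approx_normal C (\<epsilon> n) ((\<epsilon> n)\<^sup>2 * r' / K) r' x' v'"
      using that by (auto simp: P_def a)
    have \<eta>: "0 < (\<epsilon> n)\<^sup>2 * r' / K" using \<epsilon>(1)[of n] r' K by simp
    have "4 * \<epsilon> n \<le> K" using \<epsilon>(2)[of n] K by simp
    then have "4 * \<epsilon> n * (\<epsilon> n * r') \<le> K * (\<epsilon> n * r')"
      using \<epsilon>(1)[of n] r' by (intro mult_right_mono) auto
    then have \<eta>': "4 * ((\<epsilon> n)\<^sup>2 * r' / K) \<le> \<epsilon> n * r'"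
      using K by (simp add: divide_le_eq power2_eq_square mult_ac)
    have \<kappa>: "0 < (\<epsilon> (Suc n))\<^sup>2 / K" using \<epsilon>(1)[of "Suc n"] K by simp
    obtain y w s where "0 < s" "s \<le> r' / 2"
      "approx_normal C (\<epsilon> n / 2) ((\<epsilon> (Suc n))\<^sup>2 / K * s) s y w"
      "norm (y - x') \<le> 2 * ((\<epsilon> n)\<^sup>2 * r' / K) / \<epsilon> n" "norm (w - v') \<le> 3 * \<epsilon> n"
      "\<forall>z\<in>C. norm (z - y) \<le> r' / 2 \<longrightarrow> blinfun_apply v' (z - y) \<le> 3 * \<epsilon> n * norm (z - y)"
      by (rule approx_normal_refine[OF X C \<epsilon>(1) r' \<eta> \<eta>' \<kappa> v'])
    moreover have "2 * ((\<epsilon> n)\<^sup>2 * r' / K) / \<epsilon> n = 2 * \<epsilon> n * r' / K"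
      using \<epsilon>(1)[of n] by (simp add: power2_eq_square)
    ultimately show ?thesis
      by (intro exI[of _ "(y, w, s)"]) (simp add: P_def Q_def a \<epsilon>(3))
  qed
  moreover have "P 0 (x, v, r)" using v r by (simp add: P_def K_def \<epsilon>_def)
  ultimately obtain a where a: "\<And>n. P n (a n)" "\<And>n. Q n (a n) (a (Suc n))"
    using dependent_nat_choice[of P Q] by metis
  define xs where "xs n = fst (a n)" for n
  define vs where "vs n = fst (snd (a n))" for n
  define rs where "rs n = snd (snd (a n))" for n
  have an: "a n = (xs n, vs n, rs n)" for n by (simp add: xs_def vs_def rs_def)
  have rs: "0 < rs n" and inC: "xs n \<in> C" for n
    using a(1)[of n] by (simp_all add: P_def an approx_normal_def)
  have start: "xs 0 = x" "vs 0 = v" "rs 0 = r" using a(1)[of 0] by (simp_all add: P_def an)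
  have rs_half: "rs (Suc n) \<le> rs n / 2" and xs_step: "norm (xs (Suc n) - xs n) \<le> 2 * \<epsilon> n * rs n / K"
    and vs_step: "norm (vs (Suc n) - vs n) \<le> 3 * \<epsilon> n"
    and slope: "\<And>z. z \<in> C \<Longrightarrow> norm (z - xs (Suc n)) \<le> rs n / 2 \<Longrightarrow>
      blinfun_apply (vs n) (z - xs (Suc n)) \<le> 3 * \<epsilon> n * norm (z - xs (Suc n))" for n
    using a(2)[of n] by (auto simp: Q_def an)
  have pow0: "(\<lambda>n. c / 2 ^ n) \<longlonglongrightarrow> 0" for c :: real by real_asymp
  have rs_le: "rs n \<le> r / 2 ^ n" for n
  proof (induction n)
    case (Suc n)
    then show ?case using rs_half[of n] by simp
  qed (simp add: start)
  have \<epsilon>0: "\<epsilon> \<longlonglongrightarrow> 0" unfolding \<epsilon>_def by (rule pow0)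
  have rs0: "rs \<longlonglongrightarrow> 0"
    by (rule tendsto_sandwich[OF _ _ tendsto_const pow0[of r]])
      (use rs rs_le in \<open>auto intro: less_imp_le always_eventually\<close>)
  obtain y where y: "xs \<longlonglongrightarrow> y" "\<forall>n. norm (y - xs n) \<le> 4 * \<epsilon> n * rs n / K"
  proof (rule convergent_if_telescoping[of xs "\<lambda>n. 4 * \<epsilon> n * rs n / K"])
    fix n
    have "\<epsilon> n * rs (Suc n) \<le> \<epsilon> n * (rs n / 2)" using \<epsilon>(1)[of n] rs_half[of n] by (intro mult_left_mono) auto
    then have "2 * \<epsilon> n * rs n \<le> 4 * \<epsilon> n * rs n - 4 * \<epsilon> (Suc n) * rs (Suc n)"
      using mult_pos_pos[OF \<epsilon>(1)[of n] rs[of n]] by (simp add: \<epsilon>(3))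
    then have "2 * \<epsilon> n * rs n / K \<le> (4 * \<epsilon> n * rs n - 4 * \<epsilon> (Suc n) * rs (Suc n)) / K"
      using K by (intro divide_right_mono) auto
    then show "norm (xs (Suc n) - xs n) \<le> 4 * \<epsilon> n * rs n / K - 4 * \<epsilon> (Suc n) * rs (Suc n) / K"
      using xs_step[of n] by (simp add: diff_divide_distrib)
  next
    have "(\<lambda>n. 4 * \<epsilon> n * rs n / K) \<longlonglongrightarrow> 4 * 0 * 0 / K"
      using K by (intro tendsto_intros \<epsilon>0 rs0) auto
    then show "(\<lambda>n. 4 * \<epsilon> n * rs n / K) \<longlonglongrightarrow> 0" by simp
  qed
  obtain w where w: "vs \<longlonglongrightarrow> w" "\<forall>n. norm (w - vs n) \<le> 6 * \<epsilon> n"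
  proof (rule convergent_if_telescoping[of vs "\<lambda>n. 6 * \<epsilon> n"])
    show "norm (vs (Suc n) - vs n) \<le> 6 * \<epsilon> n - 6 * \<epsilon> (Suc n)" for n
      using vs_step[of n] by (simp add: \<epsilon>(3))
    show "(\<lambda>n. 6 * \<epsilon> n) \<longlonglongrightarrow> 0" using tendsto_mult_right_zero[OF \<epsilon>0] .
  qed
  have yC: "y \<in> C" using C inC y(1) by (rule closed_sequentially)
  have vs_norm: "norm (vs n) + 3 * \<epsilon> n \<le> K / 8" for n
  proof -
    have "norm (vs n) \<le> norm w + 6 * \<epsilon> n" using spec[OF w(2), of n] norm_triangle_ineq4[of w "w - vs n"] by simp
    also have "norm w \<le> norm v + 6 * \<epsilon> 0" using spec[OF w(2), of 0] norm_triangle_ineq[of v "w - v"] by (simp add: start)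
    finally have "norm (vs n) + 3 * \<epsilon> n \<le> norm v + 15" using \<epsilon>(2)[of n] \<epsilon>(2)[of 0] by simp
    also have "\<dots> \<le> 2 * norm v + 20" using norm_ge_zero[of v] by linarith
    also have "\<dots> = K / 8" by (simp add: K_def)
    finally show ?thesis .
  qed
  \<comment> \<open>The 10 is 3 from the slope bound, 1 for moving the base point to
    \<open>y\<close>, and 6 for passing from \<open>vs n\<close> to \<open>w\<close>.\<close>
  have key: "blinfun_apply w (z - y) \<le> 10 * \<epsilon> n * norm (z - y)"
    if z: "z \<in> C" "norm (z - y) \<le> rs n / 4" "rs (Suc n) / 4 < norm (z - y)" for z n
  proof -
    let ?d = "norm (y - xs (Suc n))"
    have d: "?d \<le> 2 * \<epsilon> n * rs (Suc n) / K" using spec[OF y(2), of "Suc n"] by (simp add: \<epsilon>(3))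
    have "\<epsilon> n * rs (Suc n) \<le> 1 * (rs n / 2)" using \<epsilon>[of n] rs_half[of n] rs[of "Suc n"]
      by (intro mult_mono) auto
    moreover have "2 * \<epsilon> n * rs (Suc n) / K \<le> 2 * \<epsilon> n * rs (Suc n) / 4"
      using K \<epsilon>(1)[of n] rs[of "Suc n"] by (intro divide_left_mono) auto
    ultimately have "?d \<le> rs n / 4" using d by simp
    then have near: "norm (z - xs (Suc n)) \<le> rs n / 2"
      using norm_triangle_ineq[of "z - y" "y - xs (Suc n)"] z(2) by simp
    have "blinfun_apply (vs n) (z - y) = blinfun_apply (vs n) (z - xs (Suc n)) - blinfun_apply (vs n) (y - xs (Suc n))"
      by (simp add: blinfun.diff_right)
    also have "\<dots> \<le> 3 * \<epsilon> n * norm (z - xs (Suc n)) + norm (vs n) * ?d"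
      using slope[OF z(1) near] norm_blinfun[of "vs n" "y - xs (Suc n)"] by simp
    also have "\<dots> \<le> 3 * \<epsilon> n * (norm (z - y) + ?d) + norm (vs n) * ?d"
      using norm_triangle_ineq[of "z - y" "y - xs (Suc n)"] \<epsilon>(1)[of n]
      by (intro add_right_mono mult_left_mono) auto
    also have "\<dots> = 3 * \<epsilon> n * norm (z - y) + (norm (vs n) + 3 * \<epsilon> n) * ?d" by (simp add: algebra_simps)
    also have "(norm (vs n) + 3 * \<epsilon> n) * ?d \<le> K / 8 * (2 * \<epsilon> n * rs (Suc n) / K)"
      using vs_norm[of n] d K by (intro mult_mono) auto
    also have "\<dots> = \<epsilon> n * (rs (Suc n) / 4)" using K by simp
    also have "\<dots> \<le> \<epsilon> n * norm (z - y)" using z(3) \<epsilon>(1)[of n] by (intro mult_left_mono) auto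
    finally have "blinfun_apply (vs n) (z - y) \<le> 4 * \<epsilon> n * norm (z - y)" by simp
    moreover have "blinfun_apply (w - vs n) (z - y) \<le> norm (w - vs n) * norm (z - y)"
      using norm_blinfun[of "w - vs n" "z - y"] by simp
    moreover have "norm (w - vs n) * norm (z - y) \<le> 6 * \<epsilon> n * norm (z - y)"
      using spec[OF w(2), of n] by (rule mult_right_mono) simp
    ultimately show ?thesis by (simp add: blinfun.diff_left)
  qed
  have "w \<in> frechet_normal_cone y C"
    unfolding frechet_normal_cone_iff
  proof (intro conjI yC allI impI)
    fix e' :: real
    assume "0 < e'"
    then have "eventually (\<lambda>n. \<epsilon> n < e' / 10) sequentially"
      using order_tendstoD(2)[OF \<epsilon>0, of "e' / 10"] by simp
    then obtain N where N: "\<And>n. N \<le> n \<Longrightarrow> \<epsilon> n < e' / 10" by (auto simp: eventually_sequentially)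
    have "blinfun_apply w (z - y) \<le> e' * norm (z - y)" if z: "z \<in> C" "norm (z - y) < rs N / 4" for z
    proof (cases "z = y")
      case False
      then have "0 < 4 * norm (z - y)" by simp
      then have "eventually (\<lambda>n. rs n < 4 * norm (z - y)) sequentially"
        using order_tendstoD(2)[OF rs0] by blast
      then have ex: "\<exists>n. rs n < 4 * norm (z - y)" by (auto simp: eventually_sequentially)
      \<comment> \<open>The first radius below \<open>4 * norm (z - y)\<close> bounds the range
        containing \<open>z\<close> from below; it comes after \<open>N\<close> because
        \<open>z\<close> is closer than \<open>rs N / 4\<close>.\<close>
      define k where "k = (LEAST n. rs n < 4 * norm (z - y))"
      have k: "rs k < 4 * norm (z - y)" unfolding k_def using ex by (rule LeastI_ex)
      have "decseq rs" using rs_half rs by (intro decseq_SucI) (smt (verit) field_sum_of_halves)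
      have "\<not> k \<le> N" using decseqD[OF \<open>decseq rs\<close>, of k N] k z(2) by linarith
      then obtain n where n: "k = Suc n" "N \<le> n" by (cases k) auto
      have "\<not> rs n < 4 * norm (z - y)" using n(1) not_less_Least[of n "\<lambda>n. rs n < 4 * norm (z - y)"]
        unfolding k_def by simp
      then have "blinfun_apply w (z - y) \<le> 10 * \<epsilon> n * norm (z - y)"
        using k n(1) by (intro key z) auto
      also have "\<dots> \<le> e' * norm (z - y)" using N[OF n(2)] by (intro mult_right_mono) auto
      finally show ?thesis .
    qed simp
    then show "\<exists>d>0. \<forall>z\<in>C. norm (z - y) < d \<longrightarrow> blinfun_apply w (z - y) \<le> e' * norm (z - y)"
      using rs[of N] by (intro exI[of _ "rs N / 4"]) auto
  qed
  moreover have "norm (y - x) \<le> r"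
  proof -
    have "4 * \<epsilon> 0 * r \<le> K * r" using \<epsilon>(2)[of 0] K r by (intro mult_right_mono) auto
    then have "4 * \<epsilon> 0 * r / K \<le> r" using K by (simp add: divide_le_eq mult.commute)
    then show ?thesis using spec[OF y(2), of 0] by (simp add: start)
  qed
  moreover have "norm (w - v) \<le> 6 * e" using spec[OF w(2), of 0] by (simp add: start \<epsilon>_def)
  ultimately show ?thesis using that by blast
qed

subsection \<open>The extremal principle\<close>

lemma locally_closed_around_common:
  fixes \<Omega> :: "'i \<Rightarrow> 'a::metric_space set"
  assumes "finite I" "\<And>i. i \<in> I \<Longrightarrow> locally_closed_around x (\<Omega> i)"
  obtains \<delta> where "0 < \<delta>" "\<forall>i\<in>I. closed (\<Omega> i \<inter> cball x \<delta>)"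
proof -
  have "\<exists>d. \<forall>i\<in>I. 0 < d i \<and> closed (\<Omega> i \<inter> cball x (d i))"
    using assms(2) unfolding locally_closed_around_def by (intro bchoice) blast
  then obtain d where d: "\<And>i. i \<in> I \<Longrightarrow> 0 < d i" "\<And>i. i \<in> I \<Longrightarrow> closed (\<Omega> i \<inter> cball x (d i))"
    by blast
  define \<delta> where "\<delta> = Min (insert 1 (d ` I))"
  have "0 < \<delta>" using assms(1) d(1) by (auto simp: \<delta>_def)
  moreover have "closed (\<Omega> i \<inter> cball x \<delta>)" if "i \<in> I" for i
  proof -
    have "\<delta> \<le> d i" using assms(1) that by (simp add: \<delta>_def)
    then have "\<Omega> i \<inter> cball x \<delta> = (\<Omega> i \<inter> cball x (d i)) \<inter> cball x \<delta>" by auto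
    then show ?thesis using d(2)[OF that] by (metis closed_Int closed_cball)
  qed
  ultimately show ?thesis using that by blast
qed

text \<open>This is where \<alpha> < 1 enters: for \<open>r > 0\<close> the comparison amounts to
  \<open>r powr (1 - \<alpha>) \<le> c * \<gamma>\<close>, true once \<open>r\<close> is small. And
  \<open>r > 0\<close> because \<open>x\<close> lies in every set, so zero shifts would leave it a
  common point.\<close>

lemma rated_extremal_pointE:
  assumes ext: "rated_extremal_point m \<Omega> \<alpha> x" and m: "1 \<le> m" and pos: "0 < \<tau>" "0 < c"
  obtains a r \<gamma> where "0 < r" "r < \<tau>" "0 < \<gamma>" "r \<le> c * (\<gamma> * r powr \<alpha>)"
    "\<forall>i\<in>{1..m}. norm (a i) \<le> r"
    "\<forall>y\<in>cball x (\<gamma> * r powr \<alpha>). \<exists>i\<in>{1..m}. y + a i \<notin> \<Omega> i"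
proof -
  obtain \<gamma> a where \<alpha>: "0 \<le> \<alpha>" "\<alpha> < 1" and x: "\<And>i. i \<in> {1..m} \<Longrightarrow> x \<in> \<Omega> i" and \<gamma>: "0 < \<gamma>"
    and lim: "(\<lambda>k. Max ((\<lambda>i. norm (a i k)) ` {1..m})) \<longlonglongrightarrow> 0"
    and empty: "\<forall>\<^sub>F k in sequentially. (\<Inter>i\<in>{1..m}. (\<lambda>u. u - a i k) ` \<Omega> i) \<inter>
      cball x (\<gamma> * Max ((\<lambda>i. norm (a i k)) ` {1..m}) powr \<alpha>) = {}"
    using ext unfolding rated_extremal_point_def Let_def by blast
  define r where "r k = Max ((\<lambda>i. norm (a i k)) ` {1..m})" for k
  define b where "b = (c * \<gamma>) powr (1 / (1 - \<alpha>))"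
  have b: "0 < b" using pos \<gamma> by (simp add: b_def)
  have "\<forall>\<^sub>F k in sequentially. r k < min \<tau> b"
    using order_tendstoD(2)[OF lim, of "min \<tau> b"] pos b by (simp add: r_def)
  with empty have "\<exists>k. r k < min \<tau> b \<and>
      (\<Inter>i\<in>{1..m}. (\<lambda>u. u - a i k) ` \<Omega> i) \<inter> cball x (\<gamma> * r k powr \<alpha>) = {}"
    unfolding r_def
    by (intro eventually_happens'[OF sequentially_bot] eventually_conj) auto
  then obtain k where k: "r k < min \<tau> b"
    "(\<Inter>i\<in>{1..m}. (\<lambda>u. u - a i k) ` \<Omega> i) \<inter> cball x (\<gamma> * r k powr \<alpha>) = {}" by blast
  have a_le: "norm (a i k) \<le> r k" if "i \<in> {1..m}" for i
    unfolding r_def using that by (intro Max_ge) auto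
  have sep: "\<exists>i\<in>{1..m}. y + a i k \<notin> \<Omega> i" if y: "y \<in> cball x (\<gamma> * r k powr \<alpha>)" for y
  proof (rule ccontr)
    assume neg: "\<not> ?thesis"
    have "y \<in> (\<Inter>i\<in>{1..m}. (\<lambda>u. u - a i k) ` \<Omega> i)"
    proof
      fix i
      assume "i \<in> {1..m}"
      then have "y + a i k \<in> \<Omega> i" using neg by blast
      then show "y \<in> (\<lambda>u. u - a i k) ` \<Omega> i" by (rule image_eqI[rotated]) simp
    qed
    with k(2) y show False by blast
  qed
  have "x \<in> cball x (\<gamma> * r k powr \<alpha>)" using \<gamma> by simp
  then obtain i where i: "i \<in> {1..m}" "x + a i k \<notin> \<Omega> i" using sep by blast
  then have "a i k \<noteq> 0" using x by auto
  then have r: "0 < r k" using a_le[OF i(1)] by (meson zero_less_norm_iff less_le_trans)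
  have "r k powr (1 - \<alpha>) \<le> b powr (1 - \<alpha>)" using k(1) r \<alpha> by (intro powr_mono2) auto
  also have "\<dots> = c * \<gamma>" using \<alpha> pos \<gamma> by (simp add: b_def powr_powr)
  finally have "r k powr (1 - \<alpha>) * r k powr \<alpha> \<le> c * \<gamma> * r k powr \<alpha>" by (intro mult_right_mono) auto
  moreover have "r k powr (1 - \<alpha>) * r k powr \<alpha> = r k" using r by (simp flip: powr_add)
  ultimately have "r k \<le> c * (\<gamma> * r k powr \<alpha>)" by (simp add: mult.assoc)
  moreover have "r k < \<tau>" using k(1) by simp
  ultimately show ?thesis using r \<gamma> a_le sep by (intro that[of "r k" \<gamma> "\<lambda>i. a i k"] ballI)
qed

lemma lipschitz_infdist_shift:
  fixes C :: "'a::real_normed_vector set"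
  shows "1-lipschitz_on UNIV (\<lambda>x. infdist (x + a) C)"
proof (rule lipschitz_UNIV_I)
  show "infdist (x + u + a) C \<le> infdist (x + a) C + 1 * norm u" for x u
    using infdist_triangle[of "x + u + a" C "x + a"] by (simp add: dist_norm)
qed simp

theorem theorem3p8:
  fixes \<Omega> :: "nat \<Rightarrow> 'a::banach set"
    and m :: nat and \<alpha> :: real and xbar :: 'a
  assumes "asplund TYPE('a)"
    and "m \<ge> 2"
    and "0 \<le> \<alpha>" "\<alpha> < 1"
    and "rated_extremal_point m \<Omega> \<alpha> xbar"
    and "\<And>i. i \<in> {1..m} \<Longrightarrow> locally_closed_around xbar (\<Omega> i)"
  shows "\<forall>\<epsilon>>0. \<exists>(x :: nat \<Rightarrow> 'a) (xs :: nat \<Rightarrow> 'a \<Rightarrow>\<^sub>L real).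
           (\<forall>i\<in>{1..m}. x i \<in> \<Omega> i \<inter> cball xbar \<epsilon> \<and>
              xs i \<in> frechet_normal_cone (x i) (\<Omega> i) + cball 0 \<epsilon>) \<and>
           (\<Sum>i=1..m. xs i) = 0 \<and>
           (\<Sum>i=1..m. (norm (xs i))\<^sup>2) = 1"
proof (intro allI impI)
  fix \<epsilon> :: real
  assume \<epsilon>: "0 < \<epsilon>"
  note X = assms(1)
  let ?I = "{1..m}"
  have I: "finite ?I" "?I \<noteq> {}" using assms(2) by auto
  have xbar: "xbar \<in> \<Omega> i" if "i \<in> ?I" for i
    using assms(5) that by (auto simp: rated_extremal_point_def)
  obtain \<delta> where \<delta>: "0 < \<delta>" "\<forall>i\<in>?I. closed (\<Omega> i \<inter> cball xbar \<delta>)"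
    by (rule locally_closed_around_common[OF I(1) assms(6)])
  define C where "C i = \<Omega> i \<inter> cball xbar \<delta>" for i
  have C: "closed (C i)" "xbar \<in> C i" "C i \<noteq> {}" if "i \<in> ?I" for i
    using \<delta> xbar[OF that] that by (auto simp: C_def)
  \<comment> \<open>Distances add up to \<open>8 * \<theta>\<close>: \<open>3 * \<theta>\<close>
    from \<open>xbar\<close> to \<open>x i + a i\<close>, \<open>4 * \<theta>\<close> from there to
    an almost nearest point of \<open>C i\<close>, and \<theta> for passing to an exact
    normal.\<close>
  define \<theta> where "\<theta> = min \<delta> \<epsilon> / 16"
  have \<theta>: "0 < \<theta>" "16 * \<theta> \<le> \<delta>" "16 * \<theta> \<le> \<epsilon>" using \<delta>(1) \<epsilon> by (auto simp: \<theta>_def)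
  \<comment> \<open>Exact normals will be found within \<open>12 * \<sigma>\<close>, and rescaling
    at most doubles this error. The bound \<open>8 * \<sigma> \<le> 1\<close> makes
    \<open>1 - 4 * \<sigma>\<close>, the lower bound for one of the norms, at least 1/2.\<close>
  define \<sigma> where "\<sigma> = min (1 / 8) (\<epsilon> / 24)"
  have \<sigma>: "0 < \<sigma>" "8 * \<sigma> \<le> 1" "24 * \<sigma> \<le> \<epsilon>" using \<epsilon> by (auto simp: \<sigma>_def)
  \<comment> \<open>The first bound keeps the Ekeland point within \<open>\<theta>\<close> of
    \<open>xbar\<close>, the second inside the ball where the shifted sets have no common
    point.\<close>
  have pos: "0 < min \<theta> (\<theta> * \<sigma> / m)" "0 < \<sigma> / m" using \<theta> \<sigma> assms(2) by auto
  have "1 \<le> m" using assms(2) by simp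
  then obtain a r \<gamma> where r: "0 < r" "r < min \<theta> (\<theta> * \<sigma> / m)" "0 < \<gamma>" "r \<le> \<sigma> / m * (\<gamma> * r powr \<alpha>)"
    and a: "\<forall>i\<in>?I. norm (a i) \<le> r"
    and sep: "\<forall>y\<in>cball xbar (\<gamma> * r powr \<alpha>). \<exists>i\<in>?I. y + a i \<notin> \<Omega> i"
    by (rule rated_extremal_pointE[OF assms(5) _ pos])
  have "real m * r \<le> real m * (\<theta> * \<sigma> / m)" using r(2) by (intro mult_left_mono) simp_all
  moreover have "real m * r \<le> real m * (\<sigma> / m * (\<gamma> * r powr \<alpha>))" using r(4) by (intro mult_left_mono) simp_all
  ultimately have mr: "m * r \<le> \<theta> * \<sigma>" "m * r \<le> \<sigma> * (\<gamma> * r powr \<alpha>)"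
    using assms(2) by simp_all
  define W where "W x = (\<Sum>i\<in>?I. infdist (x + a i) (C i))" for x
  have W_cont: "continuous_on UNIV W" unfolding W_def by (intro continuous_intros)
  have W_ge: "0 \<le> W x" for x by (simp add: W_def sum_nonneg infdist_nonneg)
  obtain x0 where x0: "W x0 + \<sigma> * dist x0 xbar \<le> W xbar"
    and min: "\<And>y. W x0 - \<sigma> * dist y x0 \<le> W y"
  proof (rule ekeland[OF complete_UNIV UNIV_I[of xbar] W_cont W_ge \<sigma>(1)])
    fix x0
    assume "W x0 + \<sigma> * dist x0 xbar \<le> W xbar" "\<And>y. y \<in> UNIV \<Longrightarrow> W x0 - \<sigma> * dist y x0 \<le> W y"
    then show thesis by (intro that[of x0]) simp_all
  qed
  have "W xbar \<le> (\<Sum>i\<in>?I. r)"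
    unfolding W_def
  proof (rule sum_mono)
    fix i
    assume i: "i \<in> ?I"
    have "infdist (xbar + a i) (C i) \<le> dist (xbar + a i) xbar" by (rule infdist_le[OF C(2)[OF i]])
    also have "\<dots> \<le> r" using a i by (simp add: dist_norm)
    finally show "infdist (xbar + a i) (C i) \<le> r" .
  qed
  then have dist: "\<sigma> * dist x0 xbar \<le> m * r" using x0 W_ge[of x0] by simp
  have "\<sigma> * dist x0 xbar \<le> \<sigma> * \<theta>" using dist mr(1) by (simp add: mult.commute)
  then have x0_near: "dist x0 xbar \<le> \<theta>" using \<sigma>(1) by (simp only: mult_le_cancel_left_pos)
  have "\<sigma> * dist x0 xbar \<le> \<sigma> * (\<gamma> * r powr \<alpha>)" using dist mr(2) by linarith
  then have "dist x0 xbar \<le> \<gamma> * r powr \<alpha>" using \<sigma>(1) by (simp only: mult_le_cancel_left_pos)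
  then have "x0 \<in> cball xbar (\<gamma> * r powr \<alpha>)" by (simp add: dist_commute)
  then obtain j where j: "j \<in> ?I" "x0 + a j \<notin> \<Omega> j" using sep by blast
  define d where "d = infdist (x0 + a j) (C j)"
  have d: "0 < d"
    using j(2) C(1)[OF j(1)] C(3)[OF j(1)] in_closed_iff_infdist_zero[of "C j" "x0 + a j"]
      infdist_nonneg[of "x0 + a j" "C j"]
    by (auto simp: C_def d_def less_le)
  have "eps_subgradient \<sigma> (\<lambda>x. \<Sum>i\<in>?I. infdist (x + a i) (C i)) x0 0"
  proof (rule eps_subgradientI[of 1])
    fix u :: 'a
    show "(\<Sum>i\<in>?I. infdist (x0 + a i) (C i)) + blinfun_apply 0 u - \<sigma> * norm u
        \<le> (\<Sum>i\<in>?I. infdist (x0 + u + a i) (C i))"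
      using min[of "x0 + u"] by (simp add: W_def dist_norm)
  qed simp
  \<comment> \<open>Staying within \<open>d\<close> of \<open>x0\<close> keeps the distance from
    \<open>x j + a j\<close> to \<open>C j\<close> positive, as distance functions are 1-Lipschitz;
    this prevents \<open>v j\<close> from being small.\<close>
  moreover have "0 < min \<theta> d" using \<theta> d by simp
  ultimately have "\<exists>x v. (\<forall>i\<in>?I. norm (x i - x0) < min \<theta> d \<and>
      eps_subgradient (\<sigma> + \<sigma>) (\<lambda>x. infdist (x + a i) (C i)) (x i) (v i)) \<and> (\<Sum>i\<in>?I. v i) = 0"
    using eps_subgradient_sum[OF X I lipschitz_infdist_shift, of \<sigma> a C x0 0 \<sigma> "min \<theta> d"] \<sigma>(1) by simp
  then obtain x v where x: "\<And>i. i \<in> ?I \<Longrightarrow> norm (x i - x0) < min \<theta> d"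
    and v: "\<And>i. i \<in> ?I \<Longrightarrow> eps_subgradient (\<sigma> + \<sigma>) (\<lambda>x. infdist (x + a i) (C i)) (x i) (v i)"
    and sum_v: "(\<Sum>i\<in>?I. v i) = 0"
    by blast
  have sub: "eps_subgradient (2 * \<sigma>) (\<lambda>x. infdist x (C i)) (x i + a i) (v i)" if "i \<in> ?I" for i
    using v[OF that] unfolding eps_subgradient_def by (simp add: algebra_simps)
  have "d \<le> infdist (x j + a j) (C j) + norm (x j - x0)"
    using infdist_triangle[of "x0 + a j" "C j" "x j + a j"]
    by (simp add: d_def dist_norm norm_minus_commute)
  then have "0 < infdist (x j + a j) (C j)" using x[OF j(1)] by simp
  then have "1 - 2 * (2 * \<sigma>) \<le> norm (v j)"
    using \<sigma>(1) by (intro eps_subgradient_infdist_norm_ge[OF C(3)[OF j(1)] sub[OF j(1)]]) auto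
  then have vj: "1 / 2 \<le> norm (v j)" using \<sigma>(2) by linarith
  have "\<exists>y w. dist xbar y \<le> 8 * \<theta> \<and> y \<in> \<Omega> i \<and> w \<in> frechet_normal_cone y (\<Omega> i) \<and>
      norm (w - v i) \<le> 12 * \<sigma>" if i: "i \<in> ?I" for i
  proof -
    obtain \<rho> where \<rho>: "0 < \<rho>" "\<And>\<eta>. 0 < \<eta> \<Longrightarrow> \<exists>z. dist (x i + a i) z \<le> infdist (x i + a i) (C i) + \<eta> \<and>
        approx_normal (C i) (2 * \<sigma>) \<eta> \<rho> z (v i)"
      using eps_subgradient_infdist_approx_normal[OF C(3)[OF i] sub[OF i]] by blast
    define s where "s = min \<rho> \<theta>"
    define \<eta> where "\<eta> = min \<theta> ((2 * \<sigma>)\<^sup>2 * s / (16 * (norm (v i) + 10)))"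
    have s: "0 < s" "s \<le> \<rho>" "s \<le> \<theta>" using \<rho> \<theta> by (auto simp: s_def)
    have "0 < (2 * \<sigma>)\<^sup>2 * s / (16 * (norm (v i) + 10))" using s \<sigma> by (simp add: add_nonneg_pos)
    then have \<eta>: "0 < \<eta>" "\<eta> \<le> \<theta>" "\<eta> \<le> (2 * \<sigma>)\<^sup>2 * s / (16 * (norm (v i) + 10))"
      using \<theta> by (auto simp: \<eta>_def)
    obtain z where z: "dist (x i + a i) z \<le> infdist (x i + a i) (C i) + \<eta>"
      "approx_normal (C i) (2 * \<sigma>) \<eta> \<rho> z (v i)" using \<rho>(2)[OF \<eta>(1)] by blast
    have z': "approx_normal (C i) (2 * \<sigma>) ((2 * \<sigma>)\<^sup>2 * s / (16 * (norm (v i) + 10))) s z (v i)"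
      using z(2) s(2) \<eta>(3) unfolding approx_normal_def by (meson add_left_mono order_trans)
    have \<sigma>2: "0 < 2 * \<sigma>" "2 * \<sigma> \<le> 1" using \<sigma> by auto
    obtain y w where w: "w \<in> frechet_normal_cone y (C i)" "norm (y - z) \<le> s"
      "norm (w - v i) \<le> 6 * (2 * \<sigma>)"
      by (rule frechet_normal_near_approx_normal[OF X C(1)[OF i] \<sigma>2 s(1) z'])
    have "norm (x i + a i - xbar) \<le> norm (x i - x0) + norm (x0 - xbar) + norm (a i)"
      using norm_triangle_ineq[of "x i - x0" "x0 - xbar + a i"] norm_triangle_ineq[of "x0 - xbar" "a i"]
      by (simp add: algebra_simps)
    then have near: "dist (x i + a i) xbar \<le> 3 * \<theta>"
      using x[OF i] x0_near bspec[OF a i] r(2) by (simp add: dist_norm)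
    moreover have "infdist (x i + a i) (C i) \<le> dist (x i + a i) xbar"
      by (rule infdist_le[OF C(2)[OF i]])
    ultimately have "dist (x i + a i) z \<le> 4 * \<theta>" using z(1) \<eta>(2) by simp
    then have "dist xbar y \<le> 8 * \<theta>"
      using dist_triangle[of xbar y z] dist_triangle[of xbar z "x i + a i"] near w(2) s(3)
      by (simp add: dist_norm norm_minus_commute)
    moreover from this have "dist xbar y < \<delta>" using \<theta> by linarith
    with w(1) have "w \<in> frechet_normal_cone y (\<Omega> i)"
      unfolding C_def by (rule frechet_normal_cone_local)
    moreover from this have "y \<in> \<Omega> i" by (simp add: frechet_normal_cone_iff)
    ultimately show ?thesis using w(3) by (intro exI[of _ y] exI[of _ w]) simp
  qed
  then obtain y w where y: "\<And>i. i \<in> ?I \<Longrightarrow> dist xbar (y i) \<le> 8 * \<theta>" "\<And>i. i \<in> ?I \<Longrightarrow> y i \<in> \<Omega> i"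
    and w: "\<And>i. i \<in> ?I \<Longrightarrow> w i \<in> frechet_normal_cone (y i) (\<Omega> i)"
      "\<And>i. i \<in> ?I \<Longrightarrow> norm (w i - v i) \<le> 12 * \<sigma>"
    by metis
  define S where "S = sqrt (\<Sum>i\<in>?I. (norm (v i))\<^sup>2)"
  have "(norm (v j))\<^sup>2 \<le> (\<Sum>i\<in>?I. (norm (v i))\<^sup>2)" using j(1) by (intro member_le_sum) auto
  then have "norm (v j) \<le> S" unfolding S_def by (rule real_le_rsqrt)
  with vj have S: "1 / 2 \<le> S" by linarith
  have S2: "S\<^sup>2 = (\<Sum>i\<in>?I. (norm (v i))\<^sup>2)" unfolding S_def by (simp add: sum_nonneg)
  \<comment> \<open>The \<open>v i\<close>, not the exact normals \<open>w i\<close>, are rescaled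
    into the functionals sought, since they sum to zero exactly; \<open>v i - w i\<close> goes into
    the ball.\<close>
  define c where "c = 1 / S"
  have c: "0 < c" "c \<le> 2" "c * S = 1" using S by (auto simp: c_def field_simps)
  have "c *\<^sub>R v i \<in> frechet_normal_cone (y i) (\<Omega> i) + cball 0 \<epsilon>" if i: "i \<in> ?I" for i
  proof -
    have "c *\<^sub>R w i \<in> frechet_normal_cone (y i) (\<Omega> i)"
      using w(1)[OF i] c(1) by (rule frechet_normal_cone_scaleR)
    moreover have "c * norm (v i - w i) \<le> 2 * (12 * \<sigma>)"
      using c w(2)[OF i] by (intro mult_mono) (auto simp: norm_minus_commute)
    then have "c *\<^sub>R (v i - w i) \<in> cball 0 \<epsilon>" using c(1) \<sigma>(3) by simp
    ultimately have "c *\<^sub>R w i + c *\<^sub>R (v i - w i) \<in> frechet_normal_cone (y i) (\<Omega> i) + cball 0 \<epsilon>"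
      by (rule set_plus_intro)
    then show ?thesis by (simp add: scaleR_right_diff_distrib)
  qed
  moreover have "(\<Sum>i\<in>?I. c *\<^sub>R v i) = 0" using sum_v by (simp flip: scaleR_sum_right)
  moreover have "(\<Sum>i\<in>?I. (norm (c *\<^sub>R v i))\<^sup>2) = 1"
  proof -
    have "(\<Sum>i\<in>?I. (norm (c *\<^sub>R v i))\<^sup>2) = c\<^sup>2 * S\<^sup>2"
      by (simp add: S2 power_mult_distrib sum_distrib_left)
    also have "\<dots> = (c * S)\<^sup>2" by (simp add: power_mult_distrib)
    finally show ?thesis using c(3) by simp
  qed
  moreover have "y i \<in> \<Omega> i \<inter> cball xbar \<epsilon>" if "i \<in> ?I" for i
    using y[OF that] \<theta> by simp
  ultimately show "\<exists>(x :: nat \<Rightarrow> 'a) (xs :: nat \<Rightarrow> 'a \<Rightarrow>\<^sub>L real).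
           (\<forall>i\<in>{1..m}. x i \<in> \<Omega> i \<inter> cball xbar \<epsilon> \<and>
              xs i \<in> frechet_normal_cone (x i) (\<Omega> i) + cball 0 \<epsilon>) \<and>
           (\<Sum>i=1..m. xs i) = 0 \<and>
           (\<Sum>i=1..m. (norm (xs i))\<^sup>2) = 1"
    by (intro exI[of _ y] exI[of _ "\<lambda>i. c *\<^sub>R v i"]) blast
qed

end
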